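(* Let $f\in B[a,b]$ and $\alpha\in BV[a,b]$. Then $f\in RDS_\alpha[a,b]$ if and only if the set of points of $[a,b]$ at which $f$ is discontinuous has $G(P\alpha)$-measure $0$ and $G(N\alpha)$-measure $0$, where $P\alpha$ and $N\alpha$ are the positive and negative variations of $\alpha$, and $G(P\alpha)$, $G(N\alpha)$ are the continuous parts of the saltus decompositions of $P\alpha$ and $N\alpha$ respectively.
   Context: Fix reals $a<b$. $B[a,b]$, $I[a,b]$, $BV[a,b]$ denote the bounded, the increasing (nondecreasing), and the bounded-variation real functions on $[a,b]$. $\alpha(x\pm)$ are one-sided limits, with the convention $\alpha(a-)=\alpha(a)$, $\alpha(b+)=\alpha(b)$. A partition is $\mathcal P=\{x_i\}_{i=0}^n$ with $a=x_0<\dots<x_n=b$; $I_i=(x_{i-1},x_i)$. Set $\mu_\alpha((c,d))=\alpha(d-)-\alpha(c+)$ and $\mu_\alpha(\{c\})=\alpha(c+)-\alpha(c-)$. A step function $u\in S[a,b]$ is a bounded function which, for some partition, equals a constant $c_i$ on each $I_i$ (values at partition points arbitrary); its integral is $\int_a^b u\,d\alpha=\sum_{i=0}^n u(x_i)\mu_\alpha(\{x_i\})+\sum_{i=1}^n c_i\mu_\alpha(I_i)$ (independent of the partition). RDS integral: for $\alpha\in I[a,b]$, $f\in B[a,b]$, let $L_\alpha(f,[a,b])=\sup\{\int_a^b v\,d\alpha: v\in S[a,b], v\le f\}$ and $U_\alpha(f,[a,b])=\inf\{\int_a^b u\,d\alpha: u\in S[a,b], u\ge f\}$. Write $f\in RDS_\alpha[a,b]$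 if these are equal; the common value is $\int_a^b f(x)\,d\alpha$. For $\alpha\in BV[a,b]$, $f\in RDS_\alpha[a,b]$ if there is a decomposition $\alpha=\alpha^+-\alpha^-$ with $\alpha^\pm\in I[a,b]$ and $f\in RDS_{\alpha^+}[a,b]\cap RDS_{\alpha^-}[a,b]$. Variations: $V\alpha(x)$ is the total variation of $\alpha$ on $[a,x]$, $P\alpha=\frac12(V\alpha+\alpha-\alpha(a))$, $N\alpha=\frac12(V\alpha-\alpha+\alpha(a))$; both are increasing. Saltus decomposition: for $\beta\in BV[a,b]$ with (countable) set of discontinuities $\{x_i\}$, put $H_0(x)=1$ for $x>0$ and $0$ for $x\le0$; $H_1(x)=1$ for $x\ge 0$ and $0$ for $x<0$; $S_L\beta(x)=\sum_i(\beta(x_i+)-\beta(x_i))H_0(x-x_i)$, $S_R\beta(x)=\sum_i(\beta(x_i)-\beta(x_i-))H_1(x-x_i)$; and $G\beta=\beta-S_L\beta-S_R\beta$, which is continuous (and increasing if $\beta$ is). For $\gamma\in I[a,b]$, a set $E\subset[a,b]$ has $\gamma$-measure $0$ if for every $\epsilon>0$ there are open intervals $\{J_i\}_{i=1}^\infty$ with $E\subset\bigcup_i J_i$ and $\sum_i\mu_\gamma(J_i)<\epsilon$. (For intervals reaching outside $[a,b]$, $\gamma$ is extended by the constants $\gamma(a)$ to the left of $a$ and $\gamma(b)$ to the right of $b$.) *)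

theory Defs
  imports "HOL-Analysis.Analysis"
begin

text \<open>
  Functions on \<open>[a,b]\<close> are represented by total functions on the reals; every notion
  below depends only on the values on \<open>[a,b]\<close>.
\<close>

definition bounded_funs :: "real \<Rightarrow> real \<Rightarrow> (real \<Rightarrow> real) set" where
  "bounded_funs a b = {f. bounded (f ` {a..b})}"

definition incr_funs :: "real \<Rightarrow> real \<Rightarrow> (real \<Rightarrow> real) set" where
  "incr_funs a b = {\<alpha>. mono_on {a..b} \<alpha>}"

definition discont_set :: "real \<Rightarrow> real \<Rightarrow> (real \<Rightarrow> real) \<Rightarrow> real set" where
  "discont_set a b f = {x \<in> {a..b}. \<not> continuous (at x within {a..b}) f}"


text \<open>
  The case \<open>n = 0\<close> occurs only for \<open>a = b\<close>; it makes the total variation on \<open>[a,a]\<close> equal to \<open>0\<close>.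
\<close>

definition partition_of :: "real \<Rightarrow> real \<Rightarrow> nat \<Rightarrow> (nat \<Rightarrow> real) \<Rightarrow> bool" where
  "partition_of a b n p \<longleftrightarrow> p 0 = a \<and> p n = b \<and> (\<forall>i\<in>{1..n}. p (i - 1) < p i)"

definition variation_sums :: "real \<Rightarrow> real \<Rightarrow> (real \<Rightarrow> real) \<Rightarrow> real set" where
  "variation_sums a b \<alpha> =
    {(\<Sum>i=1..n. \<bar>\<alpha> (p i) - \<alpha> (p (i - 1))\<bar>) | n p. partition_of a b n p}"

definition BV_funs :: "real \<Rightarrow> real \<Rightarrow> (real \<Rightarrow> real) set" where
  "BV_funs a b = {\<alpha>. bdd_above (variation_sums a b \<alpha>)}"

definition tot_var :: "real \<Rightarrow> (real \<Rightarrow> real) \<Rightarrow> real \<Rightarrow> real" where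
  "tot_var a \<alpha> x = Sup (variation_sums a x \<alpha>)"

definition pos_var :: "real \<Rightarrow> (real \<Rightarrow> real) \<Rightarrow> real \<Rightarrow> real" where
  "pos_var a \<alpha> x = (tot_var a \<alpha> x + \<alpha> x - \<alpha> a) / 2"

definition neg_var :: "real \<Rightarrow> (real \<Rightarrow> real) \<Rightarrow> real \<Rightarrow> real" where
  "neg_var a \<alpha> x = (tot_var a \<alpha> x - \<alpha> x + \<alpha> a) / 2"


text \<open>
  One-sided limits are those of the function extended by the constants \<open>\<alpha> a\<close> to the left of \<open>a\<close>
  and \<open>\<alpha> b\<close> to the right of \<open>b\<close>.  This yields the conventions
  \<open>\<alpha>(a-) = \<alpha>(a)\<close> and \<open>\<alpha>(b+) = \<alpha>(b)\<close>, agrees with the ordinary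
  one-sided limits elsewhere on \<open>[a,b]\<close>, and lets \<open>\<mu>_interval\<close> be applied to
  intervals reaching outside \<open>[a,b]\<close>.
\<close>

definition const_ext :: "real \<Rightarrow> real \<Rightarrow> (real \<Rightarrow> real) \<Rightarrow> real \<Rightarrow> real" where
  "const_ext a b \<alpha> x = (if x < a then \<alpha> a else if x > b then \<alpha> b else \<alpha> x)"

definition lim_left :: "real \<Rightarrow> real \<Rightarrow> (real \<Rightarrow> real) \<Rightarrow> real \<Rightarrow> real" where
  "lim_left a b \<alpha> x = Lim (at_left x) (const_ext a b \<alpha>)"

definition lim_right :: "real \<Rightarrow> real \<Rightarrow> (real \<Rightarrow> real) \<Rightarrow> real \<Rightarrow> real" where
  "lim_right a b \<alpha> x = Lim (at_right x) (const_ext a b \<alpha>)"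

definition \<mu>_interval :: "real \<Rightarrow> real \<Rightarrow> (real \<Rightarrow> real) \<Rightarrow> real \<Rightarrow> real \<Rightarrow> real" where
  "\<mu>_interval a b \<alpha> c d = lim_left a b \<alpha> d - lim_right a b \<alpha> c"

definition \<mu>_point :: "real \<Rightarrow> real \<Rightarrow> (real \<Rightarrow> real) \<Rightarrow> real \<Rightarrow> real" where
  "\<mu>_point a b \<alpha> c = lim_right a b \<alpha> c - lim_left a b \<alpha> c"


definition step_on ::
  "real \<Rightarrow> real \<Rightarrow> nat \<Rightarrow> (nat \<Rightarrow> real) \<Rightarrow> (nat \<Rightarrow> real) \<Rightarrow> (real \<Rightarrow> real) \<Rightarrow> bool" where
  "step_on a b n p c u \<longleftrightarrow>
    partition_of a b n p \<and> (\<forall>i\<in>{1..n}. \<forall>x\<in>{p (i - 1)<..<p i}. u x = c i)"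

definition step_funs :: "real \<Rightarrow> real \<Rightarrow> (real \<Rightarrow> real) set" where
  "step_funs a b = {u \<in> bounded_funs a b. \<exists>n p c. step_on a b n p c u}"

definition step_sum ::
  "real \<Rightarrow> real \<Rightarrow> (real \<Rightarrow> real) \<Rightarrow> nat \<Rightarrow> (nat \<Rightarrow> real) \<Rightarrow> (nat \<Rightarrow> real) \<Rightarrow> (real \<Rightarrow> real) \<Rightarrow> real" where
  "step_sum a b \<alpha> n p c u =
    (\<Sum>i=0..n. u (p i) * \<mu>_point a b \<alpha> (p i)) +
    (\<Sum>i=1..n. c i * \<mu>_interval a b \<alpha> (p (i - 1)) (p i))"

text \<open>
  For \<open>\<alpha>\<close> with one-sided limits, \<open>step_sum\<close> does not depend on the partition chosen for the
  step function, so the description below denotes the common value.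
\<close>

definition step_integral :: "real \<Rightarrow> real \<Rightarrow> (real \<Rightarrow> real) \<Rightarrow> (real \<Rightarrow> real) \<Rightarrow> real" where
  "step_integral a b \<alpha> u =
    (THE I. \<exists>n p c. step_on a b n p c u \<and> I = step_sum a b \<alpha> n p c u)"


definition lower_RDS :: "real \<Rightarrow> real \<Rightarrow> (real \<Rightarrow> real) \<Rightarrow> (real \<Rightarrow> real) \<Rightarrow> real" where
  "lower_RDS a b \<alpha> f =
    Sup {step_integral a b \<alpha> v | v. v \<in> step_funs a b \<and> (\<forall>x\<in>{a..b}. v x \<le> f x)}"

definition upper_RDS :: "real \<Rightarrow> real \<Rightarrow> (real \<Rightarrow> real) \<Rightarrow> (real \<Rightarrow> real) \<Rightarrow> real" where
  "upper_RDS a b \<alpha> f =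
    Inf {step_integral a b \<alpha> u | u. u \<in> step_funs a b \<and> (\<forall>x\<in>{a..b}. f x \<le> u x)}"

definition RDS_incr :: "real \<Rightarrow> real \<Rightarrow> (real \<Rightarrow> real) \<Rightarrow> (real \<Rightarrow> real) set" where
  "RDS_incr a b \<alpha> = {f \<in> bounded_funs a b. lower_RDS a b \<alpha> f = upper_RDS a b \<alpha> f}"

definition RDS :: "real \<Rightarrow> real \<Rightarrow> (real \<Rightarrow> real) \<Rightarrow> (real \<Rightarrow> real) set" where
  "RDS a b \<alpha> = {f. \<exists>\<alpha>p\<in>incr_funs a b. \<exists>\<alpha>m\<in>incr_funs a b.
     (\<forall>x\<in>{a..b}. \<alpha> x = \<alpha>p x - \<alpha>m x) \<and> f \<in> RDS_incr a b \<alpha>p \<inter> RDS_incr a b \<alpha>m}"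


definition H0 :: "real \<Rightarrow> real" where
  "H0 x = (if x > 0 then 1 else 0)"

definition H1 :: "real \<Rightarrow> real" where
  "H1 x = (if x \<ge> 0 then 1 else 0)"

definition saltus_left :: "real \<Rightarrow> real \<Rightarrow> (real \<Rightarrow> real) \<Rightarrow> real \<Rightarrow> real" where
  "saltus_left a b \<beta> x =
    (\<Sum>\<^sub>\<infinity>y\<in>discont_set a b \<beta>. (lim_right a b \<beta> y - \<beta> y) * H0 (x - y))"

definition saltus_right :: "real \<Rightarrow> real \<Rightarrow> (real \<Rightarrow> real) \<Rightarrow> real \<Rightarrow> real" where
  "saltus_right a b \<beta> x =
    (\<Sum>\<^sub>\<infinity>y\<in>discont_set a b \<beta>. (\<beta> y - lim_left a b \<beta> y) * H1 (x - y))"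

definition saltus_cont :: "real \<Rightarrow> real \<Rightarrow> (real \<Rightarrow> real) \<Rightarrow> real \<Rightarrow> real" where
  "saltus_cont a b \<beta> x = \<beta> x - saltus_left a b \<beta> x - saltus_right a b \<beta> x"


definition measure_zero :: "real \<Rightarrow> real \<Rightarrow> (real \<Rightarrow> real) \<Rightarrow> real set \<Rightarrow> bool" where
  "measure_zero a b \<gamma> E \<longleftrightarrow>
    (\<forall>\<epsilon>>0. \<exists>c d :: nat \<Rightarrow> real.
       (\<forall>i. c i < d i) \<and> E \<subseteq> (\<Union>i. {c i<..<d i}) \<and>
       summable (\<lambda>i. \<mu>_interval a b \<gamma> (c i) (d i)) \<and>
       (\<Sum>i. \<mu>_interval a b \<gamma> (c i) (d i)) < \<epsilon>)"

end

(*
  For increasing \<beta> let A be the Stieltjes measure with A (c,d) = \<beta>(d-) - \<beta>(c+).  Integrals of step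
  functions are Lebesgue integrals with respect to A, and the continuous part of \<beta> has as its
  Stieltjes measure the restriction of A to the complement of the set of atoms of A.

  If f is integrable, take step functions v n \<le> f \<le> u n whose integrals differ by less than
  1/(n+1).  Then inf (u n - v n) vanishes A-almost everywhere, and f is continuous wherever it
  vanishes, apart from the countably many partition points.  Conversely, take partitions that
  exhaust a countable dense set containing the exceptional countable set, together with the best step
  functions equal to f at the partition points; their difference tends to 0 almost everywhere, and
  dominated convergence applies.

  For \<alpha> of bounded variation, the positive and negative variations are the smallest monotone
  functions in a decomposition of \<alpha>, so null sets for any other decomposition are null for them.
*)
theory Submission
  imports Defs "HOL-Probability.Distribution_Functions"
begin

section \<open>The Stieltjes measure of an increasing function\<close>

text \<open>\<open>interval_measure\<close> expects a right-continuous distribution function; the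
  right limit is the right-continuous version of the extended \<beta>. Subtracting
  \<open>\<beta> a\<close> makes it vanish at minus infinity, so that it becomes the
  \<open>cdf\<close> itself.\<close>

definition stieltjes :: "real \<Rightarrow> real \<Rightarrow> (real \<Rightarrow> real) \<Rightarrow> real measure" where
  "stieltjes a b \<beta> = interval_measure (\<lambda>x. lim_right a b \<beta> x - \<beta> a)"

lemma sets_stieltjes [simp, measurable_cong]: "sets (stieltjes a b \<beta>) = sets borel"
  and space_stieltjes [simp]: "space (stieltjes a b \<beta>) = UNIV"
  by (simp_all add: stieltjes_def)

locale increasing_on =
  fixes a b :: real and \<beta> :: "real \<Rightarrow> real"
  assumes less: "a < b" and mono: "mono_on {a..b} \<beta>"
begin

abbreviation "g \<equiv> const_ext a b \<beta>"
abbreviation "L \<equiv> lim_left a b \<beta>"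
abbreviation "R \<equiv> lim_right a b \<beta>"
abbreviation "A \<equiv> stieltjes a b \<beta>"

section \<open>One-sided limits of the extended increasing function\<close>

lemma ext_mono: "x \<le> y \<Longrightarrow> g x \<le> g y"
  using less mono_onD[OF mono, of a b] mono_onD[OF mono, of x b] mono_onD[OF mono, of a y]
    mono_onD[OF mono, of x y]
  by (auto simp: const_ext_def)

lemma tendsto_lim_right: "(g \<longlongrightarrow> R x) (at_right x)"
proof -
  have "(g \<longlongrightarrow> Inf (g ` ({x<..} \<inter> UNIV))) (at x within ({x<..} \<inter> UNIV))"
    by (rule Lim_right_bound[of _ _ _ "g x"]) (auto intro: ext_mono)
  then have *: "(g \<longlongrightarrow> Inf (g ` {x<..})) (at_right x)" by simp
  then have "R x = Inf (g ` {x<..})"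
    unfolding lim_right_def by (intro tendsto_Lim) auto
  with * show ?thesis by simp
qed

lemma tendsto_lim_left: "(g \<longlongrightarrow> L x) (at_left x)"
proof -
  have "(g \<longlongrightarrow> Sup (g ` ({..<x} \<inter> UNIV))) (at x within ({..<x} \<inter> UNIV))"
    by (rule Lim_left_bound[of _ _ _ "g x"]) (auto intro: ext_mono)
  then have *: "(g \<longlongrightarrow> Sup (g ` {..<x})) (at_left x)" by simp
  then have "L x = Sup (g ` {..<x})"
    unfolding lim_left_def by (intro tendsto_Lim) auto
  with * show ?thesis by simp
qed

lemma le_lim_right: "g x \<le> R x"
  by (rule tendsto_lowerbound[OF tendsto_lim_right])
     (auto simp: eventually_at_right_field intro!: exI[of _ "x + 1"] ext_mono)

lemma lim_right_le: "x < y \<Longrightarrow> R x \<le> g y"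
  by (rule tendsto_upperbound[OF tendsto_lim_right])
     (auto simp: eventually_at_right_field intro!: exI[of _ y] ext_mono)

lemma lim_left_le: "L x \<le> g x"
  by (rule tendsto_upperbound[OF tendsto_lim_left])
     (auto simp: eventually_at_left_field intro!: exI[of _ "x - 1"] ext_mono)

lemma le_lim_left: "y < x \<Longrightarrow> g y \<le> L x"
  by (rule tendsto_lowerbound[OF tendsto_lim_left])
     (auto simp: eventually_at_left_field intro!: exI[of _ y] ext_mono)

lemma lim_right_mono: "x \<le> y \<Longrightarrow> R x \<le> R y"
  using lim_right_le[of x y] le_lim_right[of y] by (cases "x = y") auto

lemma lim_right_above: "b \<le> x \<Longrightarrow> R x = \<beta> b"
  using le_lim_right[of x] lim_right_le[of x "x+1"] less by (auto simp: const_ext_def split: if_splits)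

lemma lim_right_below: "x < a \<Longrightarrow> R x = \<beta> a"
  using le_lim_right[of x] lim_right_le[of x "a"] less by (auto simp: const_ext_def split: if_splits)

lemma lim_left_below: "x \<le> a \<Longrightarrow> L x = \<beta> a"
  using lim_left_le[of x] le_lim_left[of "x - 1" x] less by (auto simp: const_ext_def split: if_splits)

lemma continuous_lim_right: "continuous (at_right x) R"
  unfolding continuous_within
proof (rule order_tendstoI)
  fix l assume "l < R x"
  then show "\<forall>\<^sub>F y in at_right x. l < R y"
    by (auto simp: eventually_at_right_field intro!: exI[of _ "x + 1"]
        elim!: less_le_trans intro: lim_right_mono)
next
  fix u assume "R x < u"
  then have "\<forall>\<^sub>F y in at_right x. g y < u"
    by (rule order_tendstoD(2)[OF tendsto_lim_right])
  then obtain d where d: "x < d" "\<And>y. x < y \<Longrightarrow> y < d \<Longrightarrow> g y < u"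
    by (auto simp: eventually_at_right_field)
  \<comment> \<open>The midpoint of \<open>y\<close> and \<open>d\<close> lies strictly to the right
    of \<open>y\<close>, so \<open>g\<close> there bounds \<open>R y\<close>, and it is still below
    \<open>d\<close>, where \<open>g\<close> is less than \<open>u\<close>.\<close>
  have "R y < u" if "x < y" "y < d" for y
    using lim_right_le[of y "(y+d)/2"] d(2)[of "(y+d)/2"] that by auto
  then show "\<forall>\<^sub>F y in at_right x. R y < u"
    using d(1) by (auto simp: eventually_at_right_field)
qed

text \<open>For \<open>y < z < x\<close> one has \<open>g y \<le> R y \<le> g z \<le> L x\<close>,
  so \<open>R\<close> is trapped between \<open>g\<close> and the left limit of \<open>g\<close>.
  This later identifies the mass of an open half-line.\<close>

lemma lim_right_tendsto_left: "(R \<longlongrightarrow> L x) (at_left x)"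
proof (rule order_tendstoI)
  fix l assume "l < L x"
  then have "\<forall>\<^sub>F y in at_left x. l < g y"
    by (rule order_tendstoD(1)[OF tendsto_lim_left])
  then show "\<forall>\<^sub>F y in at_left x. l < R y"
    by eventually_elim (use le_lim_right less_le_trans in blast)
next
  fix u assume u: "L x < u"
  have "R y < u" if "y < x" for y
    using lim_right_le[of y "(y+x)/2"] le_lim_left[of "(y+x)/2" x] that u by auto
  then show "\<forall>\<^sub>F y in at_left x. R y < u"
    by (auto simp: eventually_at_left_field intro!: exI[of _ "x - 1"])
qed

section \<open>Masses of half-lines, points and intervals\<close>

lemma
  shows finite_borel_stieltjes: "finite_borel_measure A"
    and cdf_stieltjes: "cdf A x = R x - \<beta> a"
proof -
  have 1: "R x - \<beta> a \<le> R y - \<beta> a" if "x \<le> y" for x y using lim_right_mono[OF that] by simp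
  have 2: "continuous (at_right x) (\<lambda>x. R x - \<beta> a)" for x
    by (intro continuous_intros continuous_lim_right)
  have 3: "((\<lambda>x. R x - \<beta> a) \<longlongrightarrow> 0) at_bot"
    by (rule tendsto_eventually)
       (auto simp: eventually_at_bot_linorder lim_right_below intro!: exI[of _ "a - 1"])
  have 4: "((\<lambda>x. R x - \<beta> a) \<longlongrightarrow> \<beta> b - \<beta> a) at_top"
    by (rule tendsto_eventually)
       (auto simp: eventually_at_top_linorder lim_right_above intro!: exI[of _ b])
  have 5: "0 \<le> \<beta> b - \<beta> a" using mono_onD[OF mono, of a b] less by auto
  show "finite_borel_measure A"
    unfolding stieltjes_def by (rule finite_borel_measure_interval_measure[OF 1 2 3 4 5])
  show "cdf A x = R x - \<beta> a"
    unfolding stieltjes_def cdf_def by (rule measure_interval_measure_Iic[OF 1 2 3])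
qed

sublocale finite_borel_measure A by (rule finite_borel_stieltjes)

lemma measure_lessThan: "measure A {..<x} = L x - \<beta> a"
proof (rule tendsto_unique[OF _ cdf_at_left])
  show "(cdf A \<longlongrightarrow> L x - \<beta> a) (at_left x)"
    unfolding cdf_stieltjes by (intro tendsto_intros lim_right_tendsto_left)
qed simp

lemma measure_atMost: "measure A {..x} = R x - \<beta> a"
  using cdf_stieltjes[of x] by (simp add: cdf_def)

lemma mu_point: "\<mu>_point a b \<beta> x = measure A {x}"
proof -
  have "measure A ({..<x} \<union> {x}) = measure A {..<x} + measure A {x}"
    by (rule finite_measure_Union) auto
  moreover have "{..<x} \<union> {x} = {..x}" by auto
  ultimately show ?thesis
    by (simp add: \<mu>_point_def measure_lessThan measure_atMost)
qed

lemma mu_interval: "x < y \<Longrightarrow> \<mu>_interval a b \<beta> x y = measure A {x<..<y}"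
proof -
  assume "x < y"
  have "measure A ({..x} \<union> {x<..<y}) = measure A {..x} + measure A {x<..<y}"
    by (rule finite_measure_Union) auto
  moreover have "{..x} \<union> {x<..<y} = {..<y}" using \<open>x < y\<close> by auto
  ultimately show ?thesis
    by (simp add: \<mu>_interval_def measure_lessThan measure_atMost)
qed

text \<open>The total mass, the limit of the \<open>cdf\<close>, is
  \<open>\<beta> b - \<beta> a\<close>, and the conventions at the endpoints give exactly this mass
  to \<open>{..b}\<close> and none to \<open>{..<a}\<close>.\<close>

lemma null_outside: "- {a..b} \<in> null_sets A"
proof -
  have "measure A ({..b} \<union> {b<..}) = measure A {..b} + measure A {b<..}"
    by (rule finite_measure_Union) auto
  moreover have "{..b} \<union> {b<..} = UNIV" by auto
  moreover have "measure A UNIV = \<beta> b - \<beta> a"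
  proof -
    have "(cdf A \<longlongrightarrow> \<beta> b - \<beta> a) at_top"
      by (rule tendsto_eventually)
         (auto simp: cdf_stieltjes eventually_at_top_linorder lim_right_above intro!: exI[of _ b])
    then show ?thesis
      using tendsto_unique[OF _ cdf_lim_at_top] by fastforce
  qed
  ultimately have "measure A {b<..} = 0" by (simp add: measure_atMost lim_right_above)
  moreover have "measure A {..<a} = 0" by (simp add: measure_lessThan lim_left_below)
  ultimately have "{b<..} \<union> {..<a} \<in> null_sets A"
    by (intro null_sets.Un) (auto simp: null_sets_def emeasure_eq_measure)
  moreover have "{b<..} \<union> {..<a} = - {a..b}" by auto
  ultimately show ?thesis by simp
qed

section \<open>Discontinuities as atoms, and the saltus functions\<close>

lemma countable_discont: "countable (discont_set a b \<beta>)"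
  unfolding discont_set_def using mono_on_ctble_discont[OF mono] by simp

lemma discont_iff_atom: "x \<in> discont_set a b \<beta> \<longleftrightarrow> x \<in> {a..b} \<and> measure A {x} \<noteq> 0"
proof -
  have g_eq: "g y = \<beta> y" if "y \<in> {a..b}" for y using that by (simp add: const_ext_def)
  have "continuous (at x within {a..b}) \<beta> \<longleftrightarrow> measure A {x} = 0" if x: "x \<in> {a..b}"
  proof
    assume cont: "continuous (at x within {a..b}) \<beta>"
    \<comment> \<open>Clamping to \<open>[a,b]\<close> writes \<open>g\<close> as \<beta> composed
      with a continuous map. Continuity relative to \<open>[a,b]\<close> thereby becomes two-sided
      continuity of \<open>g\<close>, with the endpoints treated like all other points.\<close>
    let ?c = "\<lambda>y. max a (min b y)"
    have "continuous (at x) (\<lambda>y. \<beta> (?c y))"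
    proof (rule continuous_within_compose2[where f = ?c and g = \<beta>])
      show "continuous (at x) ?c"
        by (intro continuous_max continuous_min continuous_const continuous_ident)
      have "?c x = x" using x by auto
      then show "continuous (at (?c x) within range ?c) \<beta>"
        using cont less by (auto intro!: continuous_within_subset[OF cont])
    qed
    also have "(\<lambda>y. \<beta> (?c y)) = g"
      using less by (auto simp: fun_eq_iff const_ext_def)
    finally have "isCont g x" .
    then have "(g \<longlongrightarrow> g x) (at_left x)" "(g \<longlongrightarrow> g x) (at_right x)"
      by (auto simp: isCont_def filterlim_at_split)
    then have "L x = g x" "R x = g x"
      by (auto intro: tendsto_unique[OF _ tendsto_lim_left] tendsto_unique[OF _ tendsto_lim_right])
    then show "measure A {x} = 0" by (simp flip: mu_point add: \<mu>_point_def)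
  next
    assume "measure A {x} = 0"
    then have "L x = R x" by (simp flip: mu_point add: \<mu>_point_def)
    then have "L x = g x" "R x = g x" using lim_left_le[of x] le_lim_right[of x] by auto
    then have "isCont g x"
      using tendsto_lim_left[of x] tendsto_lim_right[of x]
      by (auto simp: isCont_def filterlim_at_split)
    then have "continuous (at x within {a..b}) g" by (rule continuous_at_imp_continuous_at_within)
    then show "continuous (at x within {a..b}) \<beta>"
      by (rule continuous_transform_within[where \<delta> = 1]) (use x g_eq in auto)
  qed
  then show ?thesis by (auto simp: discont_set_def)
qed

text \<open>Countable additivity in the language of unordered sums, which the saltus functions use;
  the passage goes through the integral against the counting measure on \<open>K\<close>.\<close>

lemma has_sum_measure:
  assumes "countable K"
  shows "((\<lambda>y. measure A {y}) has_sum measure A K) K"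
proof -
  have K: "K \<in> sets A" using assms by (simp add: sets.countable)
  have eq: "(\<integral>\<^sup>+ y. ennreal (measure A {y}) \<partial>count_space K) = ennreal (measure A K)"
    using emeasure_countable_singleton[of K A] assms K by (simp add: emeasure_eq_measure)
  have int: "integrable (count_space K) (\<lambda>y. measure A {y})"
    by (rule integrableI_nonneg) (auto simp: eq)
  have "integral\<^sup>L (count_space K) (\<lambda>y. measure A {y}) = measure A K"
    using int by (intro integral_eq_nn_integral[THEN trans]) (auto simp: eq)
  moreover have ab: "Infinite_Set_Sum.abs_summable_on (\<lambda>y. measure A {y}) K"
    using int by (simp add: Infinite_Set_Sum.abs_summable_on_def)
  ultimately have "infsum (\<lambda>y. measure A {y}) K = measure A K"
    using infsetsum_infsum[OF ab] by (simp add: infsetsum_def)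
  moreover have "(\<lambda>y. measure A {y}) summable_on K"
    using ab unfolding abs_summable_equivalent[symmetric] by simp
  ultimately show ?thesis using has_sum_infsum by metis
qed

text \<open>The mass of an atom \<open>y\<close> splits into the half-jumps
  \<open>R y - \<beta> y\<close> and \<open>\<beta> y - L y\<close>. Since \<open>H0 0 = 0\<close>
  and \<open>H1 0 = 1\<close>, both halves are subtracted for \<open>y < x\<close>, but only the
  left half for \<open>y = x\<close>. That half turns \<open>\<beta> x\<close> into
  \<open>L x\<close>, the mass of \<open>{..<x}\<close> plus \<open>\<beta> a\<close>, and the other
  terms remove the atoms below \<open>x\<close>.\<close>

lemma saltus_cont_eq:
  assumes x: "x \<in> {a..b}"
  shows "saltus_cont a b \<beta> x = \<beta> a + measure A ({..<x} - discont_set a b \<beta>)"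
proof -
  let ?J = "discont_set a b \<beta>"
  let ?K = "?J \<inter> {..<x}"
  have K: "countable ?K" using countable_discont by auto
  have J: "y \<in> {a..b}" if "y \<in> ?J" for y using that by (auto simp: discont_set_def)
  have ext: "g y = \<beta> y" if "y \<in> {a..b}" for y using that by (simp add: const_ext_def)
  have pt: "measure A {y} = (R y - \<beta> y) + (\<beta> y - L y)" for y
    by (simp flip: mu_point add: \<mu>_point_def)
  have ge: "0 \<le> R y - \<beta> y" "0 \<le> \<beta> y - L y" if "y \<in> {a..b}" for y
    using le_lim_right[of y] lim_left_le[of y] ext[OF that] by auto
  \<comment> \<open>\<open>infsum\<close> of a family that is not summable is 0 by default, so
    summability comes first: each half-jump is dominated by the mass of its atom.\<close>
  note sm = has_sum_imp_summable[OF has_sum_measure[OF K]]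
  have s1: "(\<lambda>y. R y - \<beta> y) summable_on ?K"
    by (rule summable_on_comparison_test[OF sm]) (use ge J in \<open>auto simp: pt\<close>)
  have s2: "(\<lambda>y. \<beta> y - L y) summable_on ?K"
    by (rule summable_on_comparison_test[OF sm]) (use ge J in \<open>auto simp: pt\<close>)
  have 1: "saltus_left a b \<beta> x = infsum (\<lambda>y. R y - \<beta> y) ?K"
    unfolding saltus_left_def by (rule infsum_cong_neutral) (auto simp: H0_def)
  have fin: "finite (?J \<inter> {x})" by simp
  have "saltus_right a b \<beta> x = infsum (\<lambda>y. \<beta> y - L y) (?K \<union> (?J \<inter> {x}))"
    unfolding saltus_right_def by (rule infsum_cong_neutral) (auto simp: H1_def)
  also have "\<dots> = infsum (\<lambda>y. \<beta> y - L y) ?K + infsum (\<lambda>y. \<beta> y - L y) (?J \<inter> {x})"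
    by (rule infsum_Un_disjoint) (auto simp: s2)
  \<comment> \<open>If \<beta> is continuous at \<open>x\<close>, the sum is empty, and the
    right-hand side is 0 as well because both half-jumps at \<open>x\<close> are nonnegative with
    sum 0.\<close>
  also have "infsum (\<lambda>y. \<beta> y - L y) (?J \<inter> {x}) = \<beta> x - L x"
  proof (cases "x \<in> ?J")
    case False
    then have "measure A {x} = 0" using x by (simp add: discont_iff_atom)
    then have "\<beta> x = L x" using ge[OF x] by (simp add: pt)
    with False show ?thesis by simp
  qed simp
  finally have 2: "saltus_right a b \<beta> x = infsum (\<lambda>y. \<beta> y - L y) ?K + (\<beta> x - L x)" .
  have "infsum (\<lambda>y. R y - \<beta> y) ?K + infsum (\<lambda>y. \<beta> y - L y) ?K = infsum (\<lambda>y. measure A {y}) ?K"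
    unfolding pt by (rule infsum_add[symmetric, OF s1 s2])
  also have "\<dots> = measure A ?K" by (rule infsumI[OF has_sum_measure[OF K]])
  finally have 3: "saltus_left a b \<beta> x + saltus_right a b \<beta> x = measure A ?K + (\<beta> x - L x)"
    using 1 2 by simp
  have "measure A ({..<x} - ?K) = measure A {..<x} - measure A ?K"
    by (rule finite_measure_Diff) (use K in \<open>auto intro: sets.countable\<close>)
  moreover have "{..<x} - ?K = {..<x} - ?J" by auto
  ultimately show ?thesis
    using 3 by (simp add: saltus_cont_def measure_lessThan)
qed

section \<open>The atomless part of the measure and its distribution function\<close>

lemma countable_borel: "countable C \<Longrightarrow> C \<in> sets (borel :: real measure)"
  by (rule sets.countable) auto

text \<open>\<open>A\<close> with its atoms deleted. A density keeps it a measure on all Borel sets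
  of the line, so the theory of distribution functions applies to it.\<close>

definition diffuse :: "real measure" where
  "diffuse = density A (indicator (- discont_set a b \<beta>))"

lemma sets_diffuse: "sets diffuse = sets borel" by (simp add: diffuse_def)

lemma emeasure_diffuse: "E \<in> sets borel \<Longrightarrow> emeasure diffuse E = emeasure A (E - discont_set a b \<beta>)"
proof -
  assume E: "E \<in> sets borel"
  have J: "discont_set a b \<beta> \<in> sets borel" by (rule countable_borel[OF countable_discont])
  have "emeasure diffuse E = (\<integral>\<^sup>+x. indicator (- discont_set a b \<beta>) x * indicator E x \<partial>A)"
    unfolding diffuse_def by (rule emeasure_density) (use E J in \<open>auto intro!: borel_measurable_indicator\<close>)
  also have "\<dots> = (\<integral>\<^sup>+x. indicator (E - discont_set a b \<beta>) x \<partial>A)"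
    by (rule nn_integral_cong) (auto split: split_indicator)
  finally show ?thesis using E J by simp
qed

lemma measure_diffuse: "E \<in> sets borel \<Longrightarrow> measure diffuse E = measure A (E - discont_set a b \<beta>)"
  by (simp add: measure_def emeasure_diffuse)

lemma finite_borel_diffuse: "finite_borel_measure diffuse"
proof -
  have "finite_measure diffuse"
    by standard (simp add: sets_diffuse[THEN sets_eq_imp_space_eq] emeasure_diffuse)
  then show ?thesis
    by (auto simp: finite_borel_measure_def finite_borel_measure_axioms_def sets_diffuse)
qed

lemma diffuse_point: "measure diffuse {x} = 0"
proof (cases "x \<in> discont_set a b \<beta>")
  case False
  have "measure A {x} = 0"
  proof (cases "x \<in> {a..b}")
    case False
    then have "{x} \<subseteq> - {a..b}" by auto
    then have "emeasure A {x} = 0"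
      using null_sets_subset[OF null_outside, of "{x}"] by auto
    then show ?thesis by (simp add: measure_def)
  qed (use False in \<open>simp add: discont_iff_atom\<close>)
  moreover have "{x} - discont_set a b \<beta> = {x}" using False by auto
  ultimately show ?thesis by (simp add: measure_diffuse)
qed (simp add: measure_diffuse)

lemma diffuse_countable: "countable D \<Longrightarrow> D \<in> null_sets diffuse"
proof -
  assume D: "countable D"
  interpret diffuse: finite_borel_measure diffuse by (rule finite_borel_diffuse)
  have "(\<Union>x\<in>D. {x}) \<in> null_sets diffuse"
    by (rule null_sets_UN') (use D in \<open>auto simp: null_sets_def diffuse.emeasure_eq_measure diffuse_point sets_diffuse\<close>)
  then show ?thesis by simp
qed

text \<open>By \<open>saltus_cont_eq\<close> the continuous part measures \<open>{..<x}\<close>;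
  without atoms this agrees with \<open>{..x}\<close>, and without mass outside \<open>[a,b]\<close>
  the \<open>cdf\<close> is constant there, just as the extension is. One-sided limits of the
  continuous part can then be read off from a continuous \<open>cdf\<close>.\<close>

lemma ext_saltus_cont: "const_ext a b (saltus_cont a b \<beta>) x = \<beta> a + cdf diffuse x"
proof -
  interpret diffuse: finite_borel_measure diffuse by (rule finite_borel_diffuse)
  have J: "discont_set a b \<beta> \<in> sets A" using countable_borel[OF countable_discont] by simp
  have out: "measure diffuse {b<..} = 0" "measure diffuse {..<a} = 0"
  proof -
    have "emeasure A ({b<..} - discont_set a b \<beta>) = 0" "emeasure A ({..<a} - discont_set a b \<beta>) = 0"
      using J by (auto intro!: null_setsD1[OF null_sets_subset[OF null_outside]])
    then show "measure diffuse {b<..} = 0" "measure diffuse {..<a} = 0"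
      by (simp_all add: measure_diffuse measure_def[of A])
  qed
  have less_eq: "measure diffuse {..<y} = cdf diffuse y" for y
    using tendsto_unique[OF _ diffuse.cdf_at_left[of y]] diffuse.isCont_cdf[of y] diffuse_point[of y]
    by (auto simp: isCont_def filterlim_at_split)
  have "cdf diffuse b = cdf diffuse x" if "b < x"
  proof -
    have "measure diffuse {b<..x} \<le> measure diffuse {b<..}" by (rule diffuse.finite_measure_mono) auto
    then show ?thesis using diffuse.cdf_diff_eq[OF that] out measure_nonneg[of diffuse "{b<..x}"] by linarith
  qed
  moreover have "cdf diffuse a = 0" using less_eq out by simp
  moreover have "cdf diffuse x = 0" if "x < a"
    using diffuse.cdf_nondecreasing[of x a] that diffuse.cdf_nonneg[of x] \<open>cdf diffuse a = 0\<close> by simp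
  ultimately show ?thesis
    using less by (auto simp: const_ext_def saltus_cont_eq less_eq[symmetric] measure_diffuse)
qed

lemma mu_interval_saltus_cont:
  assumes "x < y"
  shows "\<mu>_interval a b (saltus_cont a b \<beta>) x y = measure diffuse {x<..<y}"
proof -
  interpret diffuse: finite_borel_measure diffuse by (rule finite_borel_diffuse)
  have c: "isCont (\<lambda>x. \<beta> a + cdf diffuse x) z" for z
    using diffuse.isCont_cdf[of z] diffuse_point[of z] by auto
  have eq: "const_ext a b (saltus_cont a b \<beta>) = (\<lambda>x. \<beta> a + cdf diffuse x)"
    using ext_saltus_cont by auto
  have "lim_left a b (saltus_cont a b \<beta>) z = \<beta> a + cdf diffuse z"
    "lim_right a b (saltus_cont a b \<beta>) z = \<beta> a + cdf diffuse z" for z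
    unfolding lim_left_def lim_right_def eq
    using c[of z] by (auto intro!: tendsto_Lim simp: isCont_def filterlim_at_split)
  then have "\<mu>_interval a b (saltus_cont a b \<beta>) x y = measure diffuse {x<..y}"
    using diffuse.cdf_diff_eq[OF assms] by (simp add: \<mu>_interval_def)
  also have "{x<..y} = {x<..<y} \<union> {y}" using assms by auto
  also have "measure diffuse \<dots> = measure diffuse {x<..<y}"
    by (subst diffuse.finite_measure_Union) (auto simp: diffuse_point sets_diffuse)
  finally show ?thesis .
qed

end

section \<open>Null sets of the continuous part\<close>

text \<open>Turns the components of a bounded open set into intervals with real endpoints, the shape
  of cover that \<open>measure_zero\<close> asks for.\<close>

lemma open_connected_bounded_real:
  fixes S :: "real set"
  assumes "open S" "connected S" "bounded S" "S \<noteq> {}"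
  shows "Inf S < Sup S" and "S = {Inf S<..<Sup S}"
proof -
  have bd: "bdd_above S" "bdd_below S"
    using assms by (auto intro: bounded_imp_bdd_above bounded_imp_bdd_below)
  have sub: "Inf S < x \<and> x < Sup S" if x: "x \<in> S" for x
  proof -
    obtain e where e: "e > 0" "ball x e \<subseteq> S"
      using assms(1) x openE by metis
    then have "x - e/2 \<in> S" "x + e/2 \<in> S" by (auto simp: dist_real_def abs_if intro!: subsetD[OF e(2)])
    then have "Inf S \<le> x - e/2" "x + e/2 \<le> Sup S"
      using bd by (auto intro: cInf_lower cSup_upper)
    with e show ?thesis by linarith
  qed
  then show "Inf S < Sup S" using assms(4) by force
  show "S = {Inf S<..<Sup S}"
  proof (intro equalityI subsetI)
    fix x assume "x \<in> {Inf S<..<Sup S}"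
    then obtain y z where "y \<in> S" "y < x" "z \<in> S" "x < z"
      using cInf_less_iff[OF assms(4) bd(2)] less_cSup_iff[OF assms(4) bd(1)] by auto
    then show "x \<in> S"
      using assms(2) by (meson connectedD_interval less_imp_le)
  qed (use sub in auto)
qed

text \<open>Outer regularity encloses \<open>E\<close> in an open set of small mass. Its components
  are countably many disjoint open intervals, so their masses add up to the mass of the open
  set.\<close>

lemma null_set_interval_cover:
  fixes M :: "real measure"
  assumes M: "finite_borel_measure M" and E: "E \<in> null_sets M" "E \<subseteq> {a..b}"
    and out: "{b<..} \<in> null_sets M" and e: "0 < \<epsilon>"
  shows "\<exists>c d :: nat \<Rightarrow> real. (\<forall>i. c i < d i) \<and> E \<subseteq> (\<Union>i. {c i<..<d i}) \<and>
    (\<Sum>i. emeasure M {c i<..<d i}) < ennreal \<epsilon>"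
proof -
  interpret finite_borel_measure M by fact
  have "(INF U \<in> {U. E \<subseteq> U \<and> open U}. emeasure M U) = emeasure M E"
    using E by (intro outer_regular[symmetric] M_is_borel) (auto simp: M_is_borel)
  also have "\<dots> < ennreal \<epsilon>" using E e by auto
  finally obtain V where V: "E \<subseteq> V" "open V" "emeasure M V < ennreal \<epsilon>"
    by (auto simp: INF_less_iff)
  \<comment> \<open>Truncation keeps \<open>E\<close>, which lies in \<open>[a,b]\<close>, covered
    and makes every component bounded.\<close>
  define U where "U = V \<inter> {a - 1<..<b + 1}"
  have U: "E \<subseteq> U" "open U" "bounded U"
    using V E by (auto simp: U_def intro!: bounded_subset[OF bounded_closed_interval[of "a-1" "b+1"]])
  have "emeasure M U \<le> emeasure M V"
    using V by (intro emeasure_mono) (auto simp: U_def M_is_borel)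
  then have U': "emeasure M U < ennreal \<epsilon>" using V by (meson le_less_trans)
  define C where "C = components U"
  have C: "open S \<and> connected S \<and> bounded S \<and> S \<noteq> {}" if "S \<in> C" for S
    using that U unfolding C_def
    by (metis open_components in_components_connected in_components_nonempty
        bounded_subset in_components_subset)
  have disj: "disjoint C" unfolding C_def using pairwise_disjoint_components[of U] by (simp add: pairwise_def disjnt_def)
  have cnt: "countable C"
    by (rule countable_disjoint_open_subsets[OF _ disj]) (use C in auto)
  \<comment> \<open>A cover must be a full sequence of nondegenerate intervals, while there may be
    only finitely many components. \<open>h\<close> marks the indices that enumerate a component;
    all others receive the interval from \<open>b + 1\<close> to \<open>b + 2\<close>, which carries
    no mass.\<close>
  define h where "h i \<longleftrightarrow> i \<in> to_nat_on C ` C" for i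
  define K where "K i = (if h i then from_nat_into C i else {})" for i
  define c where "c i = (if h i then Inf (K i) else b + 1)" for i
  define d where "d i = (if h i then Sup (K i) else b + 2)" for i
  have K: "K i \<in> C" if "h i" for i using that cnt by (auto simp: h_def K_def)
  have ivl: "c i < d i" "h i \<Longrightarrow> {c i<..<d i} = K i" for i
    using open_connected_bounded_real[of "K i"] C[of "K i"] K[of i]
    by (auto simp: c_def d_def)
  have UK: "(\<Union>i. K i) = U"
  proof -
    have "(\<Union>i. K i) = \<Union>C" using cnt by (auto simp: K_def h_def)
    then show ?thesis by (simp add: C_def)
  qed
  have dK: "disjoint_family K"
    unfolding disjoint_family_on_def
  proof (intro ballI impI)
    fix i j :: nat assume ij: "i \<noteq> j"
    show "K i \<inter> K j = {}"
    proof (cases "h i \<and> h j")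
      case True
      then have "K i \<noteq> K j" using ij cnt by (auto simp: K_def h_def)
      then show ?thesis using disj K True by (meson pairwiseD disjnt_def)
    qed (auto simp: K_def)
  qed
  have sK: "K i \<in> sets M" for i
    using C[of "K i"] K[of i] by (cases "h i") (auto simp: M_is_borel K_def)
  have "emeasure M {c i<..<d i} = emeasure M (K i)" for i
  proof (cases "h i")
    case False
    then have "{c i<..<d i} \<subseteq> {b<..}" by (auto simp: c_def d_def)
    with False show ?thesis
      using null_setsD1[OF null_sets_subset[OF out, of "{c i<..<d i}"]] by (auto simp: K_def M_is_borel)
  qed (simp add: ivl)
  then have "(\<Sum>i. emeasure M {c i<..<d i}) = emeasure M U"
    using suminf_emeasure[OF _ dK, of M] sK UK by auto
  moreover have "E \<subseteq> (\<Union>i. {c i<..<d i})"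
  proof
    fix x assume "x \<in> E"
    then obtain i where "x \<in> K i" using U(1) UK by blast
    moreover from this have "h i" by (auto simp: K_def split: if_splits)
    ultimately show "x \<in> (\<Union>i. {c i<..<d i})" using ivl(2) by blast
  qed
  ultimately show ?thesis using ivl(1) U' by (intro exI[of _ c] exI[of _ d]) auto
qed

text \<open>
  The continuous part of \<open>\<beta>\<close> has no atoms, so countable sets are negligible for it; conversely the
  discontinuities of \<open>\<beta>\<close>, which carry the rest of the Stieltjes measure, are countable.
\<close>

definition null_mod_countable :: "real measure \<Rightarrow> real set \<Rightarrow> bool" where
  "null_mod_countable M E \<longleftrightarrow> (\<exists>D N. countable D \<and> N \<in> null_sets M \<and> E \<subseteq> D \<union> N)"

context increasing_on
begin

text \<open>A divergent series of nonnegative terms has the extended sum \<open>top\<close>, so a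
  single strict inequality in \<open>ennreal\<close> expresses both summability and the bound on the
  sum.\<close>

lemma measure_zero_iff_cover:
  "measure_zero a b (saltus_cont a b \<beta>) E \<longleftrightarrow>
    (\<forall>\<epsilon>>0. \<exists>c d :: nat \<Rightarrow> real. (\<forall>i. c i < d i) \<and> E \<subseteq> (\<Union>i. {c i<..<d i}) \<and>
      (\<Sum>i. emeasure diffuse {c i<..<d i}) < ennreal \<epsilon>)"
proof -
  interpret diffuse: finite_borel_measure diffuse by (rule finite_borel_diffuse)
  have "summable (\<lambda>i. \<mu>_interval a b (saltus_cont a b \<beta>) (c i) (d i)) \<and>
      (\<Sum>i. \<mu>_interval a b (saltus_cont a b \<beta>) (c i) (d i)) < \<epsilon> \<longleftrightarrow>
      (\<Sum>i. emeasure diffuse {c i<..<d i}) < ennreal \<epsilon>"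
    if "\<forall>i. c i < d i" "\<epsilon> > 0" for c d :: "nat \<Rightarrow> real" and \<epsilon>
  proof -
    have eq: "\<mu>_interval a b (saltus_cont a b \<beta>) (c i) (d i) = measure diffuse {c i<..<d i}" for i
      using that by (simp add: mu_interval_saltus_cont)
    show ?thesis
    proof (cases "summable (\<lambda>i. measure diffuse {c i<..<d i})")
      case True
      then have "(\<Sum>i. emeasure diffuse {c i<..<d i}) = ennreal (\<Sum>i. measure diffuse {c i<..<d i})"
        unfolding diffuse.emeasure_eq_measure by (intro suminf_ennreal2) auto
      then show ?thesis using True that
        by (simp add: eq ennreal_less_iff suminf_nonneg)
    next
      case False
      have "(\<Sum>i. emeasure diffuse {c i<..<d i}) = top"
      proof (rule ccontr)
        assume "(\<Sum>i. emeasure diffuse {c i<..<d i}) \<noteq> top"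
        then have "summable (\<lambda>i. measure diffuse {c i<..<d i})"
          unfolding diffuse.emeasure_eq_measure
          by (intro summable_suminf_not_top measure_nonneg)
        with False show False by contradiction
      qed
      then show ?thesis unfolding eq using False by simp
    qed
  qed
  then show ?thesis unfolding measure_zero_def
    by (intro all_cong1 imp_cong refl ex_cong1 conj_cong) auto
qed

text \<open>From right to left, an \<open>A\<close>-null set and a countable set are both null for
  \<open>diffuse\<close>, and the interval cover applies. From left to right, the intersection of
  covers of mass below \<open>1 / Suc k\<close> is a Borel set null for \<open>diffuse\<close>; off
  the discontinuities of \<beta> it is null for \<open>A\<close>, and those discontinuities form the
  countable exception.\<close>

lemma measure_zero_iff_null_mod_countable:
  assumes E: "E \<subseteq> {a..b}"
  shows "measure_zero a b (saltus_cont a b \<beta>) E \<longleftrightarrow> null_mod_countable A E"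
proof
  interpret diffuse: finite_borel_measure diffuse by (rule finite_borel_diffuse)
  have sJ: "discont_set a b \<beta> \<in> sets borel" by (rule countable_borel[OF countable_discont])
  assume "null_mod_countable A E"
  then obtain D N where DN: "countable D" "N \<in> null_sets A" "E \<subseteq> D \<union> N"
    by (auto simp: null_mod_countable_def)
  have "emeasure diffuse N = 0"
  proof -
    have "N - discont_set a b \<beta> \<in> null_sets A"
      by (rule null_sets_subset[OF DN(2)]) (use DN(2) sJ in auto)
    then show ?thesis using DN(2) by (subst emeasure_diffuse) auto
  qed
  then have "N \<in> null_sets diffuse" using DN(2) by (auto simp: null_sets_def sets_diffuse)
  then have "D \<union> N \<in> null_sets diffuse"
    using diffuse_countable[OF DN(1)] by (simp add: null_sets.Un)
  then have n: "(D \<union> N) \<inter> {a..b} \<in> null_sets diffuse"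
    by (rule null_set_Int2) (simp add: sets_diffuse)
  have out: "{b<..} \<in> null_sets diffuse"
  proof -
    have "{b<..} - discont_set a b \<beta> \<in> null_sets A"
      by (rule null_sets_subset[OF null_outside]) (use sJ in auto)
    then show ?thesis by (auto simp: null_sets_def sets_diffuse emeasure_diffuse)
  qed
  show "measure_zero a b (saltus_cont a b \<beta>) E"
    unfolding measure_zero_iff_cover
  proof (intro allI impI)
    fix \<epsilon> :: real assume "\<epsilon> > 0"
    from null_set_interval_cover[OF finite_borel_diffuse n _ out this, of a]
    obtain c d :: "nat \<Rightarrow> real" where "\<forall>i. c i < d i" "(D \<union> N) \<inter> {a..b} \<subseteq> (\<Union>i. {c i<..<d i})"
      "(\<Sum>i. emeasure diffuse {c i<..<d i}) < ennreal \<epsilon>" by auto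
    moreover have "E \<subseteq> (D \<union> N) \<inter> {a..b}" using E DN by auto
    ultimately show "\<exists>c d :: nat \<Rightarrow> real. (\<forall>i. c i < d i) \<and> E \<subseteq> (\<Union>i. {c i<..<d i}) \<and>
      (\<Sum>i. emeasure diffuse {c i<..<d i}) < ennreal \<epsilon>" by blast
  qed
next
  assume "measure_zero a b (saltus_cont a b \<beta>) E"
  then have "\<exists>c d :: nat \<Rightarrow> real. E \<subseteq> (\<Union>i. {c i<..<d i}) \<and>
      (\<Sum>i. emeasure diffuse {c i<..<d i}) < ennreal (1 / Suc k)" for k
    unfolding measure_zero_iff_cover by (meson divide_pos_pos of_nat_0_less_iff zero_less_Suc zero_less_one)
  then obtain c d :: "nat \<Rightarrow> nat \<Rightarrow> real" where cd:
    "\<And>k. E \<subseteq> (\<Union>i. {c k i<..<d k i})"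
    "\<And>k. (\<Sum>i. emeasure diffuse {c k i<..<d k i}) < ennreal (1 / Suc k)" by metis
  define N where "N = (\<Inter>k. \<Union>i. {c k i<..<d k i})"
  have N: "N \<in> sets borel" unfolding N_def by measurable
  have "emeasure diffuse N \<le> ennreal (1 / Suc k)" for k
  proof -
    have "emeasure diffuse N \<le> emeasure diffuse (\<Union>i. {c k i<..<d k i})"
      by (rule emeasure_mono) (auto simp: N_def sets_diffuse)
    also have "\<dots> \<le> (\<Sum>i. emeasure diffuse {c k i<..<d k i})"
      by (rule emeasure_subadditive_countably) (auto simp: sets_diffuse)
    also note cd(2)[of k]
    finally show ?thesis by simp
  qed
  moreover have "(\<lambda>k. ennreal (1 / Suc k)) \<longlonglongrightarrow> ennreal 0"
    by (intro tendsto_ennrealI LIMSEQ_Suc lim_1_over_n)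
  ultimately have "emeasure diffuse N \<le> ennreal 0"
    by (intro LIMSEQ_le_const) auto
  then have "N - discont_set a b \<beta> \<in> null_sets A"
    using N countable_borel[OF countable_discont] by (auto simp: emeasure_diffuse null_sets_def)
  then show "null_mod_countable A E"
    unfolding null_mod_countable_def using cd(1)
    by (intro exI[of _ "discont_set a b \<beta>"] exI[of _ "N - discont_set a b \<beta>"])
       (auto simp: N_def countable_discont)
qed

end

section \<open>Step functions\<close>

lemma partition_of_0: "partition_of a b 0 p \<longleftrightarrow> p 0 = a \<and> b = a"
  by (auto simp: partition_of_def)

text \<open>Dropping the last point leaves a partition of a shorter interval. The inductions on
  \<open>n\<close> below therefore generalise the right endpoint and start from the degenerate
  interval \<open>a = b\<close>.\<close>

lemma partition_of_Suc:
  "partition_of a b (Suc n) p \<longleftrightarrow> partition_of a (p n) n p \<and> p n < b \<and> p (Suc n) = b"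
  by (auto simp: partition_of_def atLeastAtMostSuc_conv)

lemma partition_of_le: "partition_of a b n p \<Longrightarrow> a \<le> b"
  by (induction n arbitrary: b) (force simp: partition_of_0 partition_of_Suc)+

lemma partition_of_subset: "partition_of a b n p \<Longrightarrow> p ` {..n} \<subseteq> {a..b}"
proof (induction n arbitrary: b)
  case (Suc n)
  then have "p ` {..n} \<subseteq> {a..p n}" "p n < b" "p (Suc n) = b" "a \<le> p n"
    by (auto simp: partition_of_Suc dest: partition_of_le)
  then show ?case unfolding atMost_Suc image_insert by auto
qed (simp add: partition_of_0)

lemma partition_of_cases:
  assumes "partition_of a b n p" "x \<in> {a..b}"
  shows "x \<in> p ` {..n} \<or> (\<exists>i\<in>{1..n}. x \<in> {p (i - 1)<..<p i})"
  using assms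
proof (induction n arbitrary: b)
  case (Suc n)
  show ?case
  proof (cases "x \<le> p n")
    case True
    then have "x \<in> p ` {..n} \<or> (\<exists>i\<in>{1..n}. x \<in> {p (i - 1)<..<p i})"
      using Suc.IH[of "p n"] Suc.prems by (auto simp: partition_of_Suc)
    then show ?thesis by (force simp: atMost_Suc)
  next
    case False
    then have "x = p (Suc n) \<or> x \<in> {p (Suc n - 1)<..<p (Suc n)}"
      using Suc.prems by (auto simp: partition_of_Suc)
    then show ?thesis by (auto simp del: diff_Suc_1)
  qed
qed (auto simp: partition_of_0)

lemma finite_set_partition:
  assumes "finite F" "F \<subseteq> {a..b}" "a \<in> F" "b \<in> F"
  shows "\<exists>n p. partition_of a b n p \<and> p ` {..n} = F"
proof -
  define xs where "xs = sorted_list_of_set F"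
  define n where "n = length xs - 1"
  have xs: "sorted_wrt (<) xs" "set xs = F" using assms(1) by (auto simp: xs_def)
  have len: "length xs = Suc n" using assms(3) xs(2) by (cases xs) (auto simp: n_def)
  have img: "(!) xs ` {..n} = F"
    using xs(2) len by (metis lessThan_Suc_atMost atLeast_upt set_map map_nth atLeast0LessThan set_upt)
  have less: "xs ! i < xs ! j" if "i < j" "j \<le> n" for i j
    using sorted_wrt_nth_less[OF xs(1)] that len by simp
  have "xs ! 0 = a"
  proof -
    obtain i where i: "i \<le> n" "xs ! i = a" using img assms(3) by force
    have "xs ! 0 \<in> F" using img by blast
    then have "a \<le> xs ! 0" using assms(2) by auto
    then show ?thesis using less[of 0 i] i by (cases "i = 0") auto
  qed
  moreover have "xs ! n = b"
  proof -
    obtain i where i: "i \<le> n" "xs ! i = b" using img assms(4) by force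
    have "xs ! n \<in> F" using img by blast
    then have "xs ! n \<le> b" using assms(2) by auto
    then show ?thesis using less[of i n] i by (cases "i = n") auto
  qed
  ultimately have "partition_of a b n ((!) xs)"
    using less by (auto simp: partition_of_def)
  with img show ?thesis by blast
qed

lemma step_on_Suc:
  "step_on a b (Suc n) p c u \<longleftrightarrow> step_on a (p n) n p c u \<and> p n < b \<and> p (Suc n) = b \<and>
    (\<forall>x\<in>{p n<..<b}. u x = c (Suc n))"
  unfolding step_on_def partition_of_Suc by (auto simp: atLeastAtMostSuc_conv)

text \<open>The sets occurring here are exactly those weighted in \<open>step_sum\<close>, so
  integrating term by term yields the step sum. The factor \<open>indicator {a..b}\<close> discards
  the values of \<open>u\<close> outside the interval, about which nothing is known.\<close>

lemma step_on_indicator: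
  assumes "step_on a b n p c u"
  shows "indicator {a..b} x * u x = (\<Sum>i=0..n. u (p i) * indicator {p i} x) +
    (\<Sum>i=1..n. c i * indicator {p (i - 1)<..<p i} (x :: real))"
  using assms
proof (induction n arbitrary: b)
  case 0
  then show ?case by (auto simp: step_on_def partition_of_0 split: split_indicator)
next
  case (Suc n)
  then have s: "step_on a (p n) n p c u" "p n < b" "p (Suc n) = b"
    "\<And>x. x \<in> {p n<..<b} \<Longrightarrow> u x = c (Suc n)" by (auto simp: step_on_Suc)
  have "a \<le> p n" using s(1) partition_of_le by (auto simp: step_on_def)
  then have "indicator {a..b} x * u x = indicator {a..p n} x * u x +
      (u b * indicator {b} x + c (Suc n) * indicator {p n<..<b} x)"
    using s(2) s(4)[of x] by (auto split: split_indicator)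
  then show ?case using Suc.IH[OF s(1)] s(3) by (simp add: algebra_simps)
qed

lemma step_on_locally_constant:
  assumes "step_on a b n p c u" "x \<in> {a..b} - p ` {..n}"
  shows "\<exists>S. open S \<and> x \<in> S \<and> S \<subseteq> {a..b} \<and> (\<forall>y\<in>S. u y = u x)"
proof -
  obtain i where i: "i \<in> {1..n}" "x \<in> {p (i - 1)<..<p i}"
    using partition_of_cases[of a b n p x] assms by (auto simp: step_on_def)
  have "p (i - 1) \<in> {a..b}" "p i \<in> {a..b}"
    using i partition_of_subset[of a b n p] assms(1) by (auto simp: step_on_def image_subset_iff)
  then show ?thesis
    using i assms(1) by (intro exI[of _ "{p (i - 1)<..<p i}"]) (auto simp: step_on_def)
qed

lemma const_step_fun: "a < b \<Longrightarrow> (\<lambda>_. k) \<in> step_funs a b"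
  unfolding step_funs_def bounded_funs_def step_on_def
  by (rule CollectI, rule conjI, simp add: image_constant_conv,
      rule exI[of _ "Suc 0"], rule exI[of _ "\<lambda>i. if i = 0 then a else b"], rule exI[of _ "\<lambda>_. k"])
     (auto simp: partition_of_def)

section \<open>Step integrals as Lebesgue integrals, and the Darboux criterion\<close>

context increasing_on
begin

lemma integrable_indicator: "E \<in> sets borel \<Longrightarrow> integrable A (indicator E :: real \<Rightarrow> real)"
  by (rule integrable_real_indicator) (auto simp: emeasure_eq_measure)

lemma step_on_integral:
  assumes "step_on a b n p c u"
  shows "integrable A (\<lambda>x. indicator {a..b} x * u x)"
    and "step_sum a b \<beta> n p c u = (\<integral>x. indicator {a..b} x * u x \<partial>A)"
proof -
  have 1: "integrable A (\<lambda>x. u (p i) * indicator {p i} x)" for i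
    by (intro integrable_mult_right integrable_indicator) auto
  have 2: "integrable A (\<lambda>x. c i * indicator {p (i - 1)<..<p i} x)" for i
    by (intro integrable_mult_right integrable_indicator) auto
  show "integrable A (\<lambda>x. indicator {a..b} x * u x)"
    unfolding step_on_indicator[OF assms]
    by (intro Bochner_Integration.integrable_add Bochner_Integration.integrable_sum 1 2)
  have "(\<integral>x. indicator {a..b} x * u x \<partial>A) =
      (\<Sum>i=0..n. u (p i) * measure A {p i}) + (\<Sum>i=1..n. c i * measure A {p (i - 1)<..<p i})"
    unfolding step_on_indicator[OF assms]
    by (simp only: Bochner_Integration.integral_add Bochner_Integration.integral_sum
        Bochner_Integration.integrable_sum 1 2) simp
  also have "\<dots> = step_sum a b \<beta> n p c u"
    using assms unfolding step_sum_def
    by (intro arg_cong2[where f = "(+)"] sum.cong refl)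
       (auto simp: mu_point mu_interval step_on_def partition_of_def)
  finally show "step_sum a b \<beta> n p c u = (\<integral>x. indicator {a..b} x * u x \<partial>A)" by simp
qed

abbreviation I :: "(real \<Rightarrow> real) \<Rightarrow> real" where
  "I u \<equiv> (\<integral>x. indicator {a..b} x * u x \<partial>A)"

text \<open>Every representation of \<open>u\<close> has the same Lebesgue integral as its step sum,
  and that integral does not mention the partition; this gives the uniqueness that the definite
  description requires.\<close>

lemma step_integral_eq: "u \<in> step_funs a b \<Longrightarrow> step_integral a b \<beta> u = I u"
  unfolding step_integral_def step_funs_def
  by (rule the_equality) (use step_on_integral(2) in \<open>(blast dest: sym)+\<close>)

lemma integrable_step: "u \<in> step_funs a b \<Longrightarrow> integrable A (\<lambda>x. indicator {a..b} x * u x)"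
  by (auto simp: step_funs_def intro: step_on_integral(1))

lemma integral_step_mono:
  assumes "u \<in> step_funs a b" "v \<in> step_funs a b" "\<And>x. x \<in> {a..b} \<Longrightarrow> u x \<le> v x"
  shows "I u \<le> I v"
  by (rule integral_mono) (use assms in \<open>auto intro: integrable_step split: split_indicator\<close>)

text \<open>Boundedness of \<open>f\<close> provides constant step functions below and above it, so
  both sets of integrals are nonempty, and each bounds the other. Hence \<open>Sup\<close> and
  \<open>Inf\<close> are genuine bounds, and equality means that the gap between them can be made
  arbitrarily small.\<close>

lemma RDS_incr_iff:
  assumes f: "f \<in> bounded_funs a b"
  shows "f \<in> RDS_incr a b \<beta> \<longleftrightarrow> (\<forall>\<epsilon>>0. \<exists>u\<in>step_funs a b. \<exists>v\<in>step_funs a b.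
    (\<forall>x\<in>{a..b}. v x \<le> f x \<and> f x \<le> u x) \<and> I u - I v < \<epsilon>)"
proof -
  define Lo where "Lo = {step_integral a b \<beta> v | v. v \<in> step_funs a b \<and> (\<forall>x\<in>{a..b}. v x \<le> f x)}"
  define Up where "Up = {step_integral a b \<beta> u | u. u \<in> step_funs a b \<and> (\<forall>x\<in>{a..b}. f x \<le> u x)}"
  have LoI: "I v \<in> Lo" if "v \<in> step_funs a b" "\<forall>x\<in>{a..b}. v x \<le> f x" for v
    using that step_integral_eq[of v, symmetric] unfolding Lo_def by blast
  have UpI: "I u \<in> Up" if "u \<in> step_funs a b" "\<forall>x\<in>{a..b}. f x \<le> u x" for u
    using that step_integral_eq[of u, symmetric] unfolding Up_def by blast
  obtain K where K: "\<forall>x\<in>{a..b}. \<bar>f x\<bar> \<le> K"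
    using f by (auto simp: bounded_funs_def bounded_iff)
  have ne: "Lo \<noteq> {}" "Up \<noteq> {}"
    using LoI[OF const_step_fun[OF less], of "-K"] UpI[OF const_step_fun[OF less], of K] K
    by (force simp: abs_le_iff)+
  have le: "l \<le> m" if "l \<in> Lo" "m \<in> Up" for l m
    using that unfolding Lo_def Up_def
    by (force simp: step_integral_eq intro!: integral_step_mono intro: order_trans)
  have bd: "bdd_above Lo" "bdd_below Up" using le ne by (meson bdd_above.I bdd_below.I ex_in_conv)+
  have iff: "f \<in> RDS_incr a b \<beta> \<longleftrightarrow> Sup Lo = Inf Up"
    using f by (simp add: RDS_incr_def lower_RDS_def upper_RDS_def Lo_def Up_def)
  have SI: "Sup Lo \<le> Inf Up"
    by (intro cSup_least cInf_greatest ne le)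
  show ?thesis
    unfolding iff
  proof (intro iffI allI impI)
    fix \<epsilon> :: real assume eq: "Sup Lo = Inf Up" and e: "\<epsilon> > 0"
    obtain l where l: "l \<in> Lo" "Sup Lo - \<epsilon>/2 < l"
      using less_cSupD[OF ne(1), of "Sup Lo - \<epsilon>/2"] e by auto
    obtain m where m: "m \<in> Up" "m < Inf Up + \<epsilon>/2"
      using cInf_lessD[OF ne(2), of "Inf Up + \<epsilon>/2"] e by auto
    obtain v where v: "v \<in> step_funs a b" "\<forall>x\<in>{a..b}. v x \<le> f x" "l = I v"
      using l(1) step_integral_eq by (auto simp: Lo_def)
    obtain u where u: "u \<in> step_funs a b" "\<forall>x\<in>{a..b}. f x \<le> u x" "m = I u"
      using m(1) step_integral_eq by (auto simp: Up_def)
    show "\<exists>u\<in>step_funs a b. \<exists>v\<in>step_funs a b.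
      (\<forall>x\<in>{a..b}. v x \<le> f x \<and> f x \<le> u x) \<and> I u - I v < \<epsilon>"
      using u v l(2) m(2) eq by (intro bexI[of _ u] bexI[of _ v]) auto
  next
    assume *: "\<forall>\<epsilon>>0. \<exists>u\<in>step_funs a b. \<exists>v\<in>step_funs a b.
      (\<forall>x\<in>{a..b}. v x \<le> f x \<and> f x \<le> u x) \<and> I u - I v < \<epsilon>"
    have "Inf Up \<le> Sup Lo + \<epsilon>" if e: "\<epsilon> > 0" for \<epsilon>
    proof -
      obtain u v where uv: "u \<in> step_funs a b" "v \<in> step_funs a b"
        "\<forall>x\<in>{a..b}. v x \<le> f x" "\<forall>x\<in>{a..b}. f x \<le> u x" "I u - I v < \<epsilon>"
        using *[rule_format, OF e] by blast
      have "Inf Up \<le> I u" "I v \<le> Sup Lo"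
        using UpI[of u] LoI[of v] uv bd by (auto intro: cInf_lower cSup_upper)
      with uv show ?thesis by simp
    qed
    then have "Inf Up \<le> Sup Lo" by (rule field_le_epsilon)
    with SI show "Sup Lo = Inf Up" by simp
  qed
qed

end

section \<open>The Lebesgue criterion for increasing integrators\<close>

lemma step_fun_locally_constant:
  assumes "u \<in> step_funs a b"
  shows "\<exists>Q. finite Q \<and> (\<forall>x\<in>{a..b} - Q. \<exists>S. open S \<and> x \<in> S \<and> S \<subseteq> {a..b} \<and> (\<forall>y\<in>S. u y = u x))"
proof -
  obtain n p c where "step_on a b n p c u" using assms by (auto simp: step_funs_def)
  then show ?thesis
    using step_on_locally_constant[of a b n p c u]
    by (intro exI[of _ "p ` {..n}"]) (simp add: Ball_def)
qed

lemma uminus_step_fun: "u \<in> step_funs a b \<Longrightarrow> (\<lambda>x. - u x) \<in> step_funs a b"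
proof -
  assume u: "u \<in> step_funs a b"
  then obtain n p c where "step_on a b n p c u" by (auto simp: step_funs_def)
  then have "step_on a b n p (\<lambda>i. - c i) (\<lambda>x. - u x)" by (auto simp: step_on_def)
  moreover have "bounded ((\<lambda>x. - u x) ` {a..b})"
    using u bounded_uminus[of "u ` {a..b}"] by (simp add: step_funs_def bounded_funs_def image_image)
  ultimately show ?thesis by (auto simp: step_funs_def bounded_funs_def)
qed

text \<open>For \<open>x\<close> outside a finite \<open>F\<close> this is the gap of
  \<open>F\<close> in \<open>[a,b]\<close> around \<open>x\<close>. Describing it by order relations
  to points of \<open>F\<close> avoids any enumeration of \<open>F\<close>.\<close>

definition cell :: "real \<Rightarrow> real \<Rightarrow> real set \<Rightarrow> real \<Rightarrow> real set" where
  "cell a b F x = {y \<in> {a..b} - F. \<forall>z\<in>F. z < x \<longleftrightarrow> z < y}"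

text \<open>The least majorant of \<open>f\<close> that is constant on the gaps of \<open>F\<close>,
  with equality on \<open>F\<close>. The corresponding minorant is obtained by applying it to the
  negative of \<open>f\<close>.\<close>

definition upper_step :: "real \<Rightarrow> real \<Rightarrow> real set \<Rightarrow> (real \<Rightarrow> real) \<Rightarrow> real \<Rightarrow> real" where
  "upper_step a b F f x = (if x \<in> F then f x else Sup (f ` cell a b F x))"

lemma upper_step_ge:
  assumes "\<forall>y\<in>{a..b}. \<bar>f y\<bar> \<le> K" "x \<in> {a..b}"
  shows "f x \<le> upper_step a b F f x"
proof (cases "x \<in> F")
  case False
  have "bdd_above (f ` cell a b F x)"
    using assms by (intro bdd_aboveI2[of _ _ K]) (auto simp: cell_def abs_le_iff)
  then have "f x \<le> Sup (f ` cell a b F x)"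
    using False assms by (intro cSup_upper) (auto simp: cell_def)
  with False show ?thesis by (simp add: upper_step_def)
qed (simp add: upper_step_def)

lemma upper_step_le:
  assumes "x \<in> {a..b}" "f x \<le> k" "\<And>y. y \<in> cell a b F x \<Longrightarrow> f y \<le> k"
  shows "upper_step a b F f x \<le> k"
proof (cases "x \<in> F")
  case False
  then have "Sup (f ` cell a b F x) \<le> k"
    using assms by (intro cSup_least) (auto simp: cell_def)
  with False show ?thesis by (simp add: upper_step_def)
qed (simp add: upper_step_def assms)

lemma upper_step_abs_le:
  assumes "\<forall>y\<in>{a..b}. \<bar>f y\<bar> \<le> K" "x \<in> {a..b}"
  shows "\<bar>upper_step a b F f x\<bar> \<le> K"
proof -
  have "upper_step a b F f x \<le> K"
    by (rule upper_step_le) (use assms in \<open>auto simp: cell_def abs_le_iff\<close>)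
  moreover have "- K \<le> f x" using bspec[OF assms] by linarith
  ultimately show ?thesis using upper_step_ge[OF assms, of F] by linarith
qed

lemma upper_step_step_fun:
  assumes K: "\<forall>y\<in>{a..b}. \<bar>f y\<bar> \<le> K" and F: "finite F" "F \<subseteq> {a..b}" "a \<in> F" "b \<in> F"
  shows "upper_step a b F f \<in> step_funs a b"
proof -
  obtain n p where p: "partition_of a b n p" "p ` {..n} = F"
    using finite_set_partition[OF F] by blast
  have mono: "p i \<le> p j" if "i \<le> j" "j \<le> n" for i j
    using that
  proof (induction j rule: dec_induct)
    case (step k)
    have "p k < p (Suc k)"
      using p(1) step by (auto simp: partition_of_def dest!: bspec[of _ _ "Suc k"])
    with step show ?case by simp
  qed simp
  \<comment> \<open>The midpoint represents its gap: no point of \<open>F\<close> separates it from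
    another point of the gap, so both have the same \<open>cell\<close>.\<close>
  define c where "c i = upper_step a b F f ((p (i - 1) + p i) / 2)" for i
  have "upper_step a b F f x = c i" if i: "i \<in> {1..n}" and x: "x \<in> {p (i - 1)<..<p i}" for i x
  proof -
    have sep: "z \<le> p (i - 1) \<or> p i \<le> z" if z: "z \<in> F" for z
    proof -
      obtain j where j: "j \<le> n" "z = p j" using z p(2) by auto
      show ?thesis
        using mono[of j "i - 1"] mono[of i j] j i by (cases "j \<le> i - 1") auto
    qed
    let ?m = "(p (i - 1) + p i) / 2"
    have m: "?m \<in> {p (i - 1)<..<p i}" using x by auto
    have "x \<notin> F" "?m \<notin> F" using sep[of x] sep[of ?m] x m by auto
    moreover have "z < x \<longleftrightarrow> z < ?m" if "z \<in> F" for z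
      using sep[OF that] x m by auto
    then have "cell a b F x = cell a b F ?m" by (auto simp: cell_def)
    ultimately show ?thesis by (simp add: c_def upper_step_def)
  qed
  then have "step_on a b n p c (upper_step a b F f)"
    using p(1) by (simp add: step_on_def)
  moreover have "bounded (upper_step a b F f ` {a..b})"
    unfolding bounded_iff using upper_step_abs_le[OF K] by (intro exI[of _ K]) auto
  ultimately show ?thesis by (auto simp: step_funs_def bounded_funs_def)
qed

text \<open>Once \<open>F n\<close> contains rationals on both sides of \<open>x\<close> within
  \<delta>, the cell of \<open>x\<close> stays in the \<delta>-neighbourhood, where \<open>f\<close>
  exceeds \<open>f x\<close> by at most \<open>e/2\<close>; halving \<open>e\<close> pays for the
  non-strict bound on the supremum. At \<open>a\<close> and \<open>b\<close> no such pair exists,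
  but these points eventually lie in \<open>F n\<close> themselves.\<close>

lemma upper_step_tendsto:
  assumes K: "\<forall>y\<in>{a..b}. \<bar>f y\<bar> \<le> K"
    and ev: "\<And>q. q \<in> \<rat> \<inter> {a..b} \<union> {a,b} \<Longrightarrow> \<forall>\<^sub>F n in sequentially. q \<in> F n"
    and x: "x \<in> {a..b}" and cont: "continuous (at x within {a..b}) f"
  shows "(\<lambda>n. upper_step a b (F n) f x) \<longlonglongrightarrow> f x"
proof (cases "x = a \<or> x = b")
  case True
  then have "\<forall>\<^sub>F n in sequentially. x \<in> F n" using ev by auto
  then have "\<forall>\<^sub>F n in sequentially. upper_step a b (F n) f x = f x"
    by eventually_elim (simp add: upper_step_def)
  then show ?thesis by (rule tendsto_eventually)
next
  case False
  then have ab: "a < x" "x < b" using x by auto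
  show ?thesis
  proof (rule tendstoI)
    fix e :: real assume e: "0 < e"
    then obtain \<delta> where d: "\<delta> > 0" "\<And>y. y \<in> {a..b} \<Longrightarrow> dist y x < \<delta> \<Longrightarrow> dist (f y) (f x) < e/2"
      using cont by (auto simp: continuous_within_eps_delta dest!: spec[of _ "e/2"])
    obtain r where r: "r \<in> \<rat>" "max a (x - \<delta>) < r" "r < x"
      using Rats_dense_in_real[of "max a (x - \<delta>)" x] ab d(1) by auto
    obtain s where s: "s \<in> \<rat>" "x < s" "s < min b (x + \<delta>)"
      using Rats_dense_in_real[of x "min b (x + \<delta>)"] ab d(1) by auto
    have "\<forall>\<^sub>F n in sequentially. r \<in> F n" "\<forall>\<^sub>F n in sequentially. s \<in> F n"
      using r s ab by (auto intro!: ev)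
    then show "\<forall>\<^sub>F n in sequentially. dist (upper_step a b (F n) f x) (f x) < e"
    proof eventually_elim
      case (elim n)
      have "upper_step a b (F n) f x \<le> f x + e/2"
      proof (rule upper_step_le[OF x])
        fix y assume y: "y \<in> cell a b (F n) x"
        then have "r < y" "y \<le> s" "y \<in> {a..b}" using elim r s by (auto simp: cell_def)
        then have "dist y x < \<delta>" using r s by (auto simp: dist_real_def)
        then show "f y \<le> f x + e/2"
          using d(2)[OF \<open>y \<in> {a..b}\<close>] abs_ge_self[of "f y - f x"] by (simp add: dist_real_def)
      qed (use e in auto)
      then show ?case
        using upper_step_ge[OF K x, of "F n"] e by (auto simp: dist_real_def)
    qed
  qed
qed

section \<open>The two directions of the criterion for an increasing integrator\<close>

context increasing_on
begin

lemma RDS_incr_imp_null_mod_countable: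
  assumes f: "f \<in> RDS_incr a b \<beta>"
  shows "null_mod_countable A (discont_set a b f)"
proof -
  have "f \<in> bounded_funs a b" using f by (simp add: RDS_incr_def)
  note crit = RDS_incr_iff[OF this, THEN iffD1, OF f, rule_format]
  let ?P = "\<lambda>n u v. u \<in> step_funs a b \<and> v \<in> step_funs a b \<and>
      (\<forall>x\<in>{a..b}. v x \<le> f x \<and> f x \<le> u x) \<and> I u - I v < 1 / real (Suc n)"
  have "\<forall>n. \<exists>u v. ?P n u v"
  proof
    fix n
    show "\<exists>u v. ?P n u v" using crit[of "1 / real (Suc n)"] by (auto simp: Bex_def)
  qed
  from choice[OF this] obtain u where "\<forall>n. \<exists>v. ?P n (u n) v" by blast
  from choice[OF this] obtain v where P: "\<forall>n. ?P n (u n) (v n)" by blast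
  then have u: "\<And>n. u n \<in> step_funs a b" and v: "\<And>n. v n \<in> step_funs a b" and
    uv: "\<And>n x. x \<in> {a..b} \<Longrightarrow> v n x \<le> f x \<and> f x \<le> u n x" and
    I: "\<And>n. I (u n) - I (v n) < 1 / Suc n" by blast+
  from choice[OF allI[OF step_fun_locally_constant[OF u]]]
  obtain Qu where *: "\<forall>n. finite (Qu n) \<and> (\<forall>x\<in>{a..b} - Qu n.
      \<exists>S. open S \<and> x \<in> S \<and> S \<subseteq> {a..b} \<and> (\<forall>y\<in>S. u n y = u n x))" ..
  have Qu: "finite (Qu n)" "x \<in> {a..b} - Qu n \<Longrightarrow>
      \<exists>S. open S \<and> x \<in> S \<and> S \<subseteq> {a..b} \<and> (\<forall>y\<in>S. u n y = u n x)" for n x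
    using *[rule_format, of n] by (simp, elim conjE bspec)
  from choice[OF allI[OF step_fun_locally_constant[OF v]]]
  obtain Qv where *: "\<forall>n. finite (Qv n) \<and> (\<forall>x\<in>{a..b} - Qv n.
      \<exists>S. open S \<and> x \<in> S \<and> S \<subseteq> {a..b} \<and> (\<forall>y\<in>S. v n y = v n x))" ..
  have Qv: "finite (Qv n)" "x \<in> {a..b} - Qv n \<Longrightarrow>
      \<exists>S. open S \<and> x \<in> S \<and> S \<subseteq> {a..b} \<and> (\<forall>y\<in>S. v n y = v n x)" for n x
    using *[rule_format, of n] by (simp, elim conjE bspec)
  define w where "w n x = indicator {a..b} x * u n x - indicator {a..b} x * v n x" for n x
  have w_int: "integrable A (w n)" for n
    unfolding w_def by (intro Bochner_Integration.integrable_diff integrable_step u v)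
  have w_nonneg: "0 \<le> w n x" for n x
    using uv[of x n] by (auto simp: w_def split: split_indicator)
  have w_le: "(\<integral>\<^sup>+x. ennreal (w n x) \<partial>A) \<le> ennreal (1 / Suc n)" for n
  proof -
    have "(\<integral>\<^sup>+x. ennreal (w n x) \<partial>A) = ennreal (\<integral>x. w n x \<partial>A)"
      by (rule nn_integral_eq_integral[OF w_int]) (simp add: w_nonneg)
    also have "(\<integral>x. w n x \<partial>A) = I (u n) - I (v n)"
      unfolding w_def by (intro Bochner_Integration.integral_diff integrable_step u v)
    finally show ?thesis using I[of n] by (simp add: ennreal_leI)
  qed
  \<comment> \<open>The infimum lies below every \<open>w n\<close>, so its integral is at most
    \<open>1 / Suc n\<close> for each \<open>n\<close>, hence 0.\<close>
  define h where "h x = (INF n. ennreal (w n x))" for x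
  have wm: "w n \<in> borel_measurable A" for n using w_int by auto
  have hm: "h \<in> borel_measurable A"
    unfolding h_def using wm by measurable
  have "integral\<^sup>N A h \<le> ennreal (1 / Suc n)" for n
    by (rule order_trans[OF nn_integral_mono w_le[of n]]) (auto simp: h_def intro: INF_lower)
  moreover have "(\<lambda>k. ennreal (1 / Suc k)) \<longlonglongrightarrow> ennreal 0"
    by (intro tendsto_ennrealI LIMSEQ_Suc lim_1_over_n)
  ultimately have "integral\<^sup>N A h \<le> ennreal 0"
    by (intro LIMSEQ_le_const) auto
  then have N: "{x. h x \<noteq> 0} \<in> null_sets A"
    using nn_integral_0_iff[OF hm] hm by (auto simp: null_sets_def)
  have "x \<in> (\<Union>n. Qu n \<union> Qv n) \<union> {x. h x \<noteq> 0}" if "x \<in> discont_set a b f" for x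
  proof (rule ccontr)
    assume "\<not> ?thesis"
    then have nQ: "\<And>n. x \<notin> Qu n" "\<And>n. x \<notin> Qv n" and h0: "h x = 0" by auto
    have x: "x \<in> {a..b}" using that by (simp add: discont_set_def)
    have "continuous (at x within {a..b}) f"
      unfolding continuous_within
    proof (rule tendstoI)
      fix e :: real assume e: "0 < e"
      have "h x < ennreal e" using h0 e by simp
      then obtain n where "ennreal (w n x) < ennreal e" by (auto simp: h_def INF_less_iff)
      then have we: "w n x < e" using w_nonneg[of n x] by (simp add: ennreal_less_iff)
      \<comment> \<open>Away from the partition points both step functions are constant near
        \<open>x\<close>, so there \<open>f\<close> is confined to a band of width
        \<open>u n x - v n x < e\<close>.\<close>
      obtain S where S: "open S" "x \<in> S" "S \<subseteq> {a..b}" "\<forall>y\<in>S. u n y = u n x"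
        using Qu(2)[of x n] x nQ by auto
      obtain T where T: "open T" "x \<in> T" "T \<subseteq> {a..b}" "\<forall>y\<in>T. v n y = v n x"
        using Qv(2)[of x n] x nQ by auto
      have "dist (f y) (f x) < e" if "y \<in> S \<inter> T" for y
      proof -
        have y: "y \<in> {a..b}" using that S(3) by blast
        moreover have "u n y = u n x" using that S(4) by blast
        moreover have "v n y = v n x" using that T(4) by blast
        moreover have "u n x - v n x < e" using we x by (simp add: w_def)
        ultimately show ?thesis
          using uv[OF x, of n] uv[OF y, of n] by (simp add: dist_real_def abs_if)
      qed
      then show "\<forall>\<^sub>F y in at x within {a..b}. dist (f y) (f x) < e"
        unfolding eventually_at_topological using S(1,2) T(1,2)
        by (intro exI[of _ "S \<inter> T"]) (simp add: open_Int)
    qed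
    then show False using that by (simp add: discont_set_def)
  qed
  moreover have "countable (\<Union>n. Qu n \<union> Qv n)"
    using Qu(1) Qv(1) by (auto intro: countable_finite)
  ultimately show ?thesis using N unfolding null_mod_countable_def by blast
qed

lemma null_mod_countable_imp_RDS_incr:
  assumes f: "f \<in> bounded_funs a b" and null: "null_mod_countable A (discont_set a b f)"
  shows "f \<in> RDS_incr a b \<beta>"
proof -
  obtain D N where DN: "countable D" "N \<in> null_sets A" "discont_set a b f \<subseteq> D \<union> N"
    using null by (auto simp: null_mod_countable_def)
  obtain K where K: "\<forall>x\<in>{a..b}. \<bar>f x\<bar> \<le> K"
    using f by (auto simp: bounded_funs_def bounded_iff)
  define f' where "f' x = - f x" for x
  have K': "\<forall>x\<in>{a..b}. \<bar>f' x\<bar> \<le> K" using K by (simp add: f'_def)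
  \<comment> \<open>The rationals make the partition points dense, and \<open>D\<close> is included
    because at its points, where \<open>f\<close> may be discontinuous, the step functions
    eventually agree with \<open>f\<close>.\<close>
  define Q where "Q = (D \<union> \<rat> \<union> {a, b}) \<inter> {a..b}"
  have Q: "countable Q" "Q \<noteq> {}"
    using DN(1) less countable_rat by (auto simp: Q_def)
  define F where "F n = {a, b} \<union> from_nat_into Q ` {..n}" for n
  have "from_nat_into Q i \<in> {a..b}" for i
    using from_nat_into[OF Q(2), of i] unfolding Q_def by blast
  then have F: "finite (F n)" "F n \<subseteq> {a..b}" "a \<in> F n" "b \<in> F n" for n
    using less by (auto simp: F_def)
  have ev: "\<forall>\<^sub>F n in sequentially. q \<in> F n" if "q \<in> Q" for q
  proof -
    obtain m where "q = from_nat_into Q m" using from_nat_into_surj[OF Q(1) \<open>q \<in> Q\<close>] by auto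
    then show ?thesis by (auto simp: F_def eventually_sequentially intro!: exI[of _ m])
  qed
  define u where "u n = upper_step a b (F n) f" for n
  define v where "v n x = - upper_step a b (F n) f' x" for n x
  have u: "u n \<in> step_funs a b" for n
    unfolding u_def by (rule upper_step_step_fun[OF K F])
  have v: "v n \<in> step_funs a b" for n
    unfolding v_def by (intro uminus_step_fun upper_step_step_fun[OF K' F])
  have uv: "v n x \<le> f x" "f x \<le> u n x" if "x \<in> {a..b}" for n x
    using upper_step_ge[OF K that, of "F n"] upper_step_ge[OF K' that, of "F n"]
    unfolding u_def v_def f'_def[of x] by auto
  have lim: "(\<lambda>n. u n x - v n x) \<longlonglongrightarrow> 0" if x: "x \<in> {a..b}" "x \<notin> N" for x
  proof (cases "x \<in> D")
    case True
    then have "\<forall>\<^sub>F n in sequentially. x \<in> F n" using x by (intro ev) (auto simp: Q_def)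
    then have "\<forall>\<^sub>F n in sequentially. u n x - v n x = 0"
      by eventually_elim (simp add: u_def v_def f'_def upper_step_def)
    then show ?thesis by (rule tendsto_eventually)
  next
    case False
    then have c: "continuous (at x within {a..b}) f" using x DN by (auto simp: discont_set_def)
    then have c': "continuous (at x within {a..b}) f'" unfolding f'_def by (intro continuous_intros)
    have ev': "\<forall>\<^sub>F n in sequentially. q \<in> F n" if "q \<in> \<rat> \<inter> {a..b} \<union> {a, b}" for q
      using that less by (intro ev) (auto simp: Q_def)
    have "(\<lambda>n. upper_step a b (F n) f x + upper_step a b (F n) f' x) \<longlonglongrightarrow> f x + f' x"
      by (intro tendsto_add upper_step_tendsto[OF K ev' x(1) c] upper_step_tendsto[OF K' ev' x(1) c'])
    then show ?thesis by (simp add: u_def v_def f'_def)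
  qed
  define w where "w n x = indicator {a..b} x * u n x - indicator {a..b} x * v n x" for n x
  have w_int: "integrable A (w n)" for n
    unfolding w_def by (intro Bochner_Integration.integrable_diff integrable_step u v)
  \<comment> \<open>Both step functions are bounded by \<open>K\<close> in absolute value, so the
    constant \<open>2 * K\<close> dominates; it is integrable because \<open>A\<close> is
    finite.\<close>
  have "(\<lambda>n. \<integral>x. w n x \<partial>A) \<longlonglongrightarrow> (\<integral>x. 0 \<partial>A)"
  proof (rule integral_dominated_convergence[where w = "\<lambda>_. 2 * K"])
    show "AE x in A. (\<lambda>n. w n x) \<longlonglongrightarrow> 0"
      by (rule AE_I'[OF DN(2)]) (use lim in \<open>auto simp: w_def split: split_indicator\<close>)
    show "AE x in A. norm (w n x) \<le> 2 * K" for n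
    proof (rule AE_I2)
      fix x
      have "0 \<le> K" using K less by (force dest!: bspec[of _ _ a])
      then show "norm (w n x) \<le> 2 * K"
        using upper_step_abs_le[OF K, of x "F n"] upper_step_abs_le[OF K', of x "F n"]
        by (auto simp: w_def u_def v_def split: split_indicator)
    qed
  qed (use w_int in auto)
  moreover have "(\<integral>x. w n x \<partial>A) = I (u n) - I (v n)" for n
    unfolding w_def by (intro Bochner_Integration.integral_diff integrable_step u v)
  ultimately have "(\<lambda>n. I (u n) - I (v n)) \<longlonglongrightarrow> 0" by simp
  then have "\<exists>n. I (u n) - I (v n) < \<epsilon>" if "\<epsilon> > 0" for \<epsilon>
    using order_tendstoD(2)[OF _ that] eventually_happens' sequentially_bot by blast
  then have "\<exists>n. I (u n) - I (v n) < \<epsilon> \<and> (\<forall>x\<in>{a..b}. v n x \<le> f x \<and> f x \<le> u n x)"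
    if "\<epsilon> > 0" for \<epsilon> using that uv by simp
  then show ?thesis
    unfolding RDS_incr_iff[OF f] by (meson u v)
qed

end

text \<open>As \<gamma> - \<beta> is increasing, the measure of \<beta> is at most that of \<gamma>
  on every open interval. Small interval covers of a null set for \<gamma> are then small for
  \<beta> too.\<close>

lemma null_mod_countable_mono_measure:
  assumes "increasing_on a b \<beta>" "increasing_on a b \<gamma>" "mono_on {a..b} (\<lambda>x. \<gamma> x - \<beta> x)"
    and "null_mod_countable (stieltjes a b \<gamma>) E"
  shows "null_mod_countable (stieltjes a b \<beta>) E"
proof -
  interpret B: increasing_on a b \<beta> by fact
  interpret C: increasing_on a b \<gamma> by fact
  interpret H: increasing_on a b "\<lambda>x. \<gamma> x - \<beta> x"
    using assms(3) B.less by unfold_locales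
  have g: "const_ext a b (\<lambda>x. \<gamma> x - \<beta> x) = (\<lambda>x. C.g x - B.g x)"
    by (auto simp: const_ext_def)
  have HR: "H.R x = C.R x - B.R x" for x
    using H.tendsto_lim_right[of x] tendsto_diff[OF C.tendsto_lim_right[of x] B.tendsto_lim_right[of x]]
    unfolding g by (intro tendsto_unique) auto
  have "H.L x = C.L x - B.L x" for x
    using H.tendsto_lim_left[of x] tendsto_diff[OF C.tendsto_lim_left[of x] B.tendsto_lim_left[of x]]
    unfolding g by (intro tendsto_unique) auto
  \<comment> \<open>This quantity is the difference of the two masses of the open interval; the
    value of the extended difference at the midpoint separates the two limits.\<close>
  moreover have "0 \<le> H.L y - H.R x" if "x < y" for x y
    using H.le_lim_left[of "(x+y)/2" y] H.lim_right_le[of x "(x+y)/2"] that by simp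
  ultimately have le: "measure B.A {x<..<y} \<le> measure C.A {x<..<y}" if "x < y" for x y
    using that HR[of x]
    by (fastforce simp: B.mu_interval[OF that, symmetric] C.mu_interval[OF that, symmetric] \<mu>_interval_def)
  obtain D N where DN: "countable D" "N \<in> null_sets C.A" "E \<subseteq> D \<union> N"
    using assms(4) by (auto simp: null_mod_countable_def)
  have out: "{b<..} \<in> null_sets C.A"
    by (rule null_sets_subset[OF C.null_outside]) auto
  have N1: "N \<inter> {a..b} \<in> null_sets C.A" using DN(2) by (intro null_set_Int2) auto
  have "emeasure B.A (N \<inter> {a..b}) \<le> ennreal \<epsilon>" if e: "0 < \<epsilon>" for \<epsilon>
  proof -
    obtain c d :: "nat \<Rightarrow> real" where cd: "\<forall>i. c i < d i" "N \<inter> {a..b} \<subseteq> (\<Union>i. {c i<..<d i})"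
      "(\<Sum>i. emeasure C.A {c i<..<d i}) < ennreal \<epsilon>"
      using null_set_interval_cover[OF C.finite_borel_stieltjes N1 _ out e, of a] by auto
    have "emeasure B.A (N \<inter> {a..b}) \<le> emeasure B.A (\<Union>i. {c i<..<d i})"
      by (rule emeasure_mono) (use cd in auto)
    also have "\<dots> \<le> (\<Sum>i. emeasure B.A {c i<..<d i})"
      by (rule emeasure_subadditive_countably) auto
    also have "\<dots> \<le> (\<Sum>i. emeasure C.A {c i<..<d i})"
      by (rule suminf_le) (use le cd in \<open>auto simp: B.emeasure_eq_measure C.emeasure_eq_measure intro!: ennreal_leI\<close>)
    finally show ?thesis using cd(3) by simp
  qed
  then have "emeasure B.A (N \<inter> {a..b}) \<le> 0"
    by (metis ennreal_le_epsilon add_0)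
  then have "N \<inter> {a..b} \<in> null_sets B.A" using N1 by (auto simp: null_sets_def)
  \<comment> \<open>The cover controls only the part of \<open>N\<close> inside
    \<open>[a,b]\<close>. Since \<open>E\<close> is arbitrary, the whole complement of
    \<open>[a,b]\<close> is added, which is null in any case.\<close>
  moreover have "- {a..b} \<in> null_sets B.A" by (rule B.null_outside)
  ultimately have "(N \<inter> {a..b}) \<union> - {a..b} \<in> null_sets B.A" by (rule null_sets.Un)
  then show ?thesis
    unfolding null_mod_countable_def using DN by (intro exI[of _ D] exI[of _ "(N \<inter> {a..b}) \<union> - {a..b}"]) auto
qed

section \<open>The Jordan decomposition\<close>

lemma variation_sums_append:
  assumes "s \<in> variation_sums a x \<alpha>" "x < y"
  shows "s + \<bar>\<alpha> y - \<alpha> x\<bar> \<in> variation_sums a y \<alpha>"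
proof -
  obtain n p where p: "partition_of a x n p" "s = (\<Sum>i=1..n. \<bar>\<alpha> (p i) - \<alpha> (p (i - 1))\<bar>)"
    using assms(1) by (auto simp: variation_sums_def)
  define q where "q = p(Suc n := y)"
  have q: "q i = p i" if "i \<le> n" for i using that by (simp add: q_def)
  have "partition_of a x n q" using p(1) by (auto simp: partition_of_def q)
  then have "partition_of a y (Suc n) q"
    using assms(2) by (auto simp: partition_of_Suc partition_of_def q_def)
  moreover have "(\<Sum>i=1..n. \<bar>\<alpha> (q i) - \<alpha> (q (i - 1))\<bar>) = s"
    unfolding p(2) by (rule sum.cong) (auto simp: q)
  then have "(\<Sum>i=1..Suc n. \<bar>\<alpha> (q i) - \<alpha> (q (i - 1))\<bar>) = s + \<bar>\<alpha> y - \<alpha> x\<bar>"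
    using p(1) by (simp add: q partition_of_def) (simp add: q_def)
  ultimately show ?thesis unfolding variation_sums_def by (intro CollectI exI[of _ "Suc n"] exI[of _ q]) simp
qed

lemma variation_sums_Suc:
  assumes "partition_of a y (Suc n) p"
  shows "(\<Sum>i=1..n. \<bar>\<alpha> (p i) - \<alpha> (p (i - 1))\<bar>) \<in> variation_sums a (p n) \<alpha>"
  using assms unfolding partition_of_Suc variation_sums_def by blast

lemma variation_sums_refl: "0 \<in> variation_sums a a \<alpha>"
  unfolding variation_sums_def
  by (intro CollectI exI[of _ 0] exI[of _ "\<lambda>_. a"]) (simp add: partition_of_0)

lemma variation_sums_nonempty: "a \<le> x \<Longrightarrow> variation_sums a x \<alpha> \<noteq> {}"
  using variation_sums_refl[of a \<alpha>] variation_sums_append[OF variation_sums_refl, of a x \<alpha>]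
  by (cases "x = a") auto

context
  fixes a b :: real and \<alpha> :: "real \<Rightarrow> real"
  assumes BV: "\<alpha> \<in> BV_funs a b"
begin

lemma bdd_variation_sums: "x \<le> b \<Longrightarrow> bdd_above (variation_sums a x \<alpha>)"
proof (cases "x = b")
  case False
  assume "x \<le> b"
  with False have "x < b" by simp
  obtain K where K: "\<And>s. s \<in> variation_sums a b \<alpha> \<Longrightarrow> s \<le> K"
    using BV by (auto simp: BV_funs_def bdd_above_def)
  have "s \<le> K" if "s \<in> variation_sums a x \<alpha>" for s
    using K[OF variation_sums_append[OF that \<open>x < b\<close>]] by linarith
  then show ?thesis by (rule bdd_above.I)
qed (use BV in \<open>simp add: BV_funs_def\<close>)

lemma tot_var_upper: "x \<le> b \<Longrightarrow> s \<in> variation_sums a x \<alpha> \<Longrightarrow> s \<le> tot_var a \<alpha> x"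
  unfolding tot_var_def by (rule cSup_upper[OF _ bdd_variation_sums])

text \<open>Appending \<open>y\<close> to a partition ending at \<open>x\<close> raises its
  variation sum by exactly the left-hand side.\<close>

lemma abs_diff_le_tot_var:
  assumes "a \<le> x" "x \<le> y" "y \<le> b"
  shows "\<bar>\<alpha> y - \<alpha> x\<bar> \<le> tot_var a \<alpha> y - tot_var a \<alpha> x"
proof (cases "x = y")
  case False
  have "s \<le> tot_var a \<alpha> y - \<bar>\<alpha> y - \<alpha> x\<bar>" if "s \<in> variation_sums a x \<alpha>" for s
    using tot_var_upper[OF assms(3) variation_sums_append[OF that, of y]] False assms by simp
  then have "tot_var a \<alpha> x \<le> tot_var a \<alpha> y - \<bar>\<alpha> y - \<alpha> x\<bar>"
    unfolding tot_var_def[of a \<alpha> x] by (intro cSup_least variation_sums_nonempty assms)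
  then show ?thesis by simp
qed simp

text \<open>Induction on the last piece. If \<open>x \<le> p n\<close>, the bound up to
  \<open>p n\<close> is extended by the increment of \<open>g\<close> over that piece. Otherwise
  \<open>x\<close> lies inside the piece: its increment is split at \<open>x\<close>, and the part
  up to \<open>x\<close> completes a variation sum of \<open>[a,x]\<close>.\<close>

lemma variation_sum_le:
  assumes g: "\<And>s t. a \<le> s \<Longrightarrow> s \<le> t \<Longrightarrow> t \<le> b \<Longrightarrow> \<bar>\<alpha> t - \<alpha> s\<bar> \<le> g t - g s"
    and "a \<le> x" "x \<le> y" "y \<le> b" "partition_of a y n p"
  shows "(\<Sum>i=1..n. \<bar>\<alpha> (p i) - \<alpha> (p (i - 1))\<bar>) \<le> tot_var a \<alpha> x + g y - g x"
  using assms(2-)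
proof (induction n arbitrary: y)
  case 0
  then have "y = a" "x = a" by (auto simp: partition_of_0)
  then show ?case
    using tot_var_upper[of a 0] variation_sums_refl[of a \<alpha>] 0 by simp
next
  case (Suc n)
  have p: "partition_of a (p n) n p" "p n < y" "p (Suc n) = y"
    using Suc.prems by (auto simp: partition_of_Suc)
  have an: "a \<le> p n" using partition_of_le[OF p(1)] .
  let ?S = "\<Sum>i=1..n. \<bar>\<alpha> (p i) - \<alpha> (p (i - 1))\<bar>"
  have S: "(\<Sum>i=1..Suc n. \<bar>\<alpha> (p i) - \<alpha> (p (i - 1))\<bar>) = ?S + \<bar>\<alpha> y - \<alpha> (p n)\<bar>"
    using p by simp
  show ?case
  proof (cases "x \<le> p n")
    case True
    then have "?S \<le> tot_var a \<alpha> x + g (p n) - g x"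
      using Suc.IH[of "p n"] Suc.prems p by auto
    moreover have "\<bar>\<alpha> y - \<alpha> (p n)\<bar> \<le> g y - g (p n)"
      using g[of "p n" y] an p Suc.prems by auto
    ultimately show ?thesis unfolding S by linarith
  next
    case False
    then have "?S + \<bar>\<alpha> x - \<alpha> (p n)\<bar> \<le> tot_var a \<alpha> x"
      using Suc.prems by (intro tot_var_upper variation_sums_append variation_sums_Suc) auto
    moreover have "\<bar>\<alpha> y - \<alpha> x\<bar> \<le> g y - g x"
      using g[of x y] Suc.prems by auto
    ultimately show ?thesis unfolding S by linarith
  qed
qed

lemma tot_var_diff_le:
  assumes g: "\<And>s t. a \<le> s \<Longrightarrow> s \<le> t \<Longrightarrow> t \<le> b \<Longrightarrow> \<bar>\<alpha> t - \<alpha> s\<bar> \<le> g t - g s"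
    and xy: "a \<le> x" "x \<le> y" "y \<le> b"
  shows "tot_var a \<alpha> y - tot_var a \<alpha> x \<le> g y - g x"
proof -
  have "s \<le> tot_var a \<alpha> x + g y - g x" if "s \<in> variation_sums a y \<alpha>" for s
    using that variation_sum_le[OF g xy] by (auto simp: variation_sums_def)
  then have "tot_var a \<alpha> y \<le> tot_var a \<alpha> x + g y - g x"
    unfolding tot_var_def[of a \<alpha> y] using xy by (intro cSup_least variation_sums_nonempty) auto
  then show ?thesis by simp
qed

lemma mono_pos_var: "mono_on {a..b} (pos_var a \<alpha>)"
proof (rule mono_onI)
  fix x y assume "x \<in> {a..b}" "y \<in> {a..b}" "x \<le> y"
  then show "pos_var a \<alpha> x \<le> pos_var a \<alpha> y"
    using abs_diff_le_tot_var[of x y] unfolding pos_var_def by (simp add: abs_le_iff divide_right_mono)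
qed

lemma mono_neg_var: "mono_on {a..b} (neg_var a \<alpha>)"
proof (rule mono_onI)
  fix x y assume "x \<in> {a..b}" "y \<in> {a..b}" "x \<le> y"
  then show "neg_var a \<alpha> x \<le> neg_var a \<alpha> y"
    using abs_diff_le_tot_var[of x y] unfolding neg_var_def by (simp add: abs_le_iff divide_right_mono)
qed

text \<open>With \<open>g\<close> the sum of \<open>\<alpha>p\<close> and \<open>\<alpha>m\<close>,
  increments of the total variation are at most those of \<open>g\<close>. Both differences in the
  conclusion equal half of \<open>g\<close> minus the total variation, up to a constant.\<close>

lemma jordan_minimal:
  assumes "mono_on {a..b} \<alpha>p" "mono_on {a..b} \<alpha>m" "\<And>x. x \<in> {a..b} \<Longrightarrow> \<alpha> x = \<alpha>p x - \<alpha>m x"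
  shows "mono_on {a..b} (\<lambda>x. \<alpha>p x - pos_var a \<alpha> x)" "mono_on {a..b} (\<lambda>x. \<alpha>m x - neg_var a \<alpha> x)"
proof -
  let ?g = "\<lambda>x. \<alpha>p x + \<alpha>m x"
  have g: "\<bar>\<alpha> t - \<alpha> s\<bar> \<le> ?g t - ?g s" if "a \<le> s" "s \<le> t" "t \<le> b" for s t
    using that assms(3)[of s] assms(3)[of t] mono_onD[OF assms(1), of s t] mono_onD[OF assms(2), of s t]
    by simp
  have le: "tot_var a \<alpha> y - tot_var a \<alpha> x \<le> ?g y - ?g x"
    if "x \<in> {a..b}" "y \<in> {a..b}" "x \<le> y" for x y
    using tot_var_diff_le[of ?g, OF g] that by simp
  show "mono_on {a..b} (\<lambda>x. \<alpha>p x - pos_var a \<alpha> x)"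
  proof (rule mono_onI)
    fix x y assume "x \<in> {a..b}" "y \<in> {a..b}" "x \<le> y"
    then show "\<alpha>p x - pos_var a \<alpha> x \<le> \<alpha>p y - pos_var a \<alpha> y"
      using le[of x y] assms(3)[of x] assms(3)[of y] unfolding pos_var_def by (simp add: field_simps)
  qed
  show "mono_on {a..b} (\<lambda>x. \<alpha>m x - neg_var a \<alpha> x)"
  proof (rule mono_onI)
    fix x y assume "x \<in> {a..b}" "y \<in> {a..b}" "x \<le> y"
    then show "\<alpha>m x - neg_var a \<alpha> x \<le> \<alpha>m y - neg_var a \<alpha> y"
      using le[of x y] assms(3)[of x] assms(3)[of y] unfolding neg_var_def by (simp add: field_simps)
  qed
qed

end

theorem theorem7p13:
  fixes a b :: real and f \<alpha> :: "real \<Rightarrow> real"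
  assumes "a < b"
    and "f \<in> bounded_funs a b"
    and "\<alpha> \<in> BV_funs a b"
  shows "f \<in> RDS a b \<alpha> \<longleftrightarrow>
    measure_zero a b (saltus_cont a b (pos_var a \<alpha>)) (discont_set a b f) \<and>
    measure_zero a b (saltus_cont a b (neg_var a \<alpha>)) (discont_set a b f)"
proof -
  interpret P: increasing_on a b "pos_var a \<alpha>"
    using assms(1) mono_pos_var[OF assms(3)] by unfold_locales
  interpret N: increasing_on a b "neg_var a \<alpha>"
    using assms(1) mono_neg_var[OF assms(3)] by unfold_locales
  have D: "discont_set a b f \<subseteq> {a..b}" by (auto simp: discont_set_def)
  have "f \<in> RDS a b \<alpha> \<longleftrightarrow> null_mod_countable P.A (discont_set a b f) \<and> null_mod_countable N.A (discont_set a b f)"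
  proof
    assume "f \<in> RDS a b \<alpha>"
    then obtain \<alpha>p \<alpha>m where m: "mono_on {a..b} \<alpha>p" "mono_on {a..b} \<alpha>m"
      and eq: "\<And>x. x \<in> {a..b} \<Longrightarrow> \<alpha> x = \<alpha>p x - \<alpha>m x"
      and f: "f \<in> RDS_incr a b \<alpha>p" "f \<in> RDS_incr a b \<alpha>m"
      by (auto simp: RDS_def incr_funs_def)
    interpret p: increasing_on a b \<alpha>p using assms(1) m(1) by unfold_locales
    interpret m: increasing_on a b \<alpha>m using assms(1) m(2) by unfold_locales
    note min = jordan_minimal[OF assms(3) m eq]
    show "null_mod_countable P.A (discont_set a b f) \<and> null_mod_countable N.A (discont_set a b f)"
      using null_mod_countable_mono_measure[OF P.increasing_on_axioms p.increasing_on_axioms min(1)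
          p.RDS_incr_imp_null_mod_countable[OF f(1)]]
        null_mod_countable_mono_measure[OF N.increasing_on_axioms m.increasing_on_axioms min(2)
          m.RDS_incr_imp_null_mod_countable[OF f(2)]]
      by blast
  next
    assume null: "null_mod_countable P.A (discont_set a b f) \<and> null_mod_countable N.A (discont_set a b f)"
    \<comment> \<open>The positive minus the negative variation is \<alpha> -
      \<open>\<alpha> a\<close>, so an exact decomposition of \<alpha> needs the shift by
      \<open>\<alpha> a\<close>. The comparison of measures applies because the difference of the
      two functions is constant.\<close>
    define P' where "P' x = pos_var a \<alpha> x + \<alpha> a" for x
    interpret P': increasing_on a b P'
      using P.mono assms(1) unfolding P'_def by unfold_locales (auto simp: mono_on_def)
    have "null_mod_countable P'.A (discont_set a b f)"
      by (rule null_mod_countable_mono_measure[OF P'.increasing_on_axioms P.increasing_on_axioms])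
        (use null in \<open>auto simp: P'_def mono_on_def\<close>)
    then have "f \<in> RDS_incr a b P'" "f \<in> RDS_incr a b (neg_var a \<alpha>)"
      using null by (auto intro: P'.null_mod_countable_imp_RDS_incr N.null_mod_countable_imp_RDS_incr assms(2))
    moreover have "\<alpha> x = P' x - neg_var a \<alpha> x" for x
      by (simp add: P'_def pos_var_def neg_var_def field_simps)
    ultimately show "f \<in> RDS a b \<alpha>"
      using P'.mono N.mono unfolding RDS_def incr_funs_def by blast
  qed
  then show ?thesis
    using P.measure_zero_iff_null_mod_countable[OF D] N.measure_zero_iff_null_mod_countable[OF D] by simp
qed

end
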